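(* Every Coxeter matroid $\mathcal{M}\subseteq W(E_7)/P_7$ satisfies the strong exchange condition.
   Context: $W(E_7)$ is the Weyl group of the root system $E_7$ and $P_7$ its minuscule maximal parabolic subgroup. Cosets $\sigma P_7$ are identified with the points $\sigma v$ for a fixed $v$ with $\mathrm{stab}_W(v)=P_7$; for $\mathcal{M}\subseteq W/P_7$, $\Delta(\mathcal{M})=\mathrm{conv}\{\sigma v:\sigma P_7\in\mathcal{M}\}$. $\mathcal{M}$ is a Coxeter matroid if every edge of $\Delta(\mathcal{M})$ is parallel to a root of $E_7$. $\mathcal{M}$ satisfies the strong exchange condition if for all $A,B\in\mathcal{M}$ there exists a reflection $s$ in a root of $E_7$ whose mirror separates $A$ and $B$ and such that $sA,sB\in\mathcal{M}$. *)

theory Defs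
  imports
    "HOL-Analysis.Analysis"
    "HOL-Algebra.Bij"
    "HOL-Algebra.Generated_Groups"
    "HOL-Algebra.Left_Coset"
    "HOL-Algebra.Group_Action"
begin

section \<open>Coxeter matroids for a root system\<close>

definition reflection :: "'a::real_inner \<Rightarrow> 'a \<Rightarrow> 'a" where
  "reflection \<alpha> x = x - (2 * (\<alpha> \<bullet> x) / (\<alpha> \<bullet> \<alpha>)) *\<^sub>R \<alpha>"

definition reflection_subgroup :: "'a::real_inner set \<Rightarrow> ('a \<Rightarrow> 'a) set" where
  "reflection_subgroup S = generate (BijGroup UNIV) (reflection ` S)"

definition weyl_group :: "'a::real_inner set \<Rightarrow> ('a \<Rightarrow> 'a) monoid" where
  "weyl_group \<Phi> = BijGroup UNIV \<lparr>carrier := reflection_subgroup \<Phi>\<rparr>"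

text \<open>
  In the following, \<open>P\<close> is a subgroup of the Weyl group \<open>W\<close> of \<open>\<Phi>\<close> and \<open>v\<close> is a point whose
  stabilizer in \<open>W\<close> is \<open>P\<close>, so that \<open>\<sigma> P \<mapsto> \<sigma> v\<close> identifies \<open>W / P\<close> with the orbit of \<open>v\<close>.
\<close>

definition matroid_polytope ::
  "'a::real_inner set \<Rightarrow> ('a \<Rightarrow> 'a) set \<Rightarrow> 'a \<Rightarrow> ('a \<Rightarrow> 'a) set set \<Rightarrow> 'a set" where
  "matroid_polytope \<Phi> P v M =
     convex hull {\<sigma> v | \<sigma>. \<sigma> \<in> carrier (weyl_group \<Phi>) \<and> \<sigma> <#\<^bsub>weyl_group \<Phi>\<^esub> P \<in> M}"

definition parallel_to :: "'a::real_vector set \<Rightarrow> 'a \<Rightarrow> bool" where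
  "parallel_to F \<alpha> \<longleftrightarrow> (\<forall>x\<in>F. \<forall>y\<in>F. \<exists>c. x - y = c *\<^sub>R \<alpha>)"

definition coxeter_matroid ::
  "'a::euclidean_space set \<Rightarrow> ('a \<Rightarrow> 'a) set \<Rightarrow> 'a \<Rightarrow> ('a \<Rightarrow> 'a) set set \<Rightarrow> bool" where
  "coxeter_matroid \<Phi> P v M \<longleftrightarrow>
     M \<subseteq> lcosets\<^bsub>weyl_group \<Phi>\<^esub> P \<and>
     (\<forall>F. F edge_of matroid_polytope \<Phi> P v M \<longrightarrow> (\<exists>\<alpha>\<in>\<Phi>. parallel_to F \<alpha>))"

text \<open>
  The mirror of the reflection in \<open>\<alpha>\<close> is the hyperplane orthogonal to \<open>\<alpha>\<close>; it separates two points
  if they lie strictly on opposite sides of it. A coset \<open>A = \<sigma> P\<close> is represented by the point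
  \<open>\<sigma> v\<close>, which is the same for every element \<open>\<sigma>\<close> of \<open>A\<close>.
\<close>

definition mirror_separates ::
  "'a::real_inner \<Rightarrow> 'a \<Rightarrow> ('a \<Rightarrow> 'a) set \<Rightarrow> ('a \<Rightarrow> 'a) set \<Rightarrow> bool" where
  "mirror_separates v \<alpha> A B \<longleftrightarrow> (\<forall>\<sigma>\<in>A. \<forall>\<tau>\<in>B. (\<alpha> \<bullet> \<sigma> v) * (\<alpha> \<bullet> \<tau> v) < 0)"

text \<open>
  The exchange condition is about distinct cosets: no mirror separates a coset from itself.
\<close>

definition strong_exchange ::
  "'a::real_inner set \<Rightarrow> 'a \<Rightarrow> ('a \<Rightarrow> 'a) set set \<Rightarrow> bool" where
  "strong_exchange \<Phi> v M \<longleftrightarrow>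
     (\<forall>A\<in>M. \<forall>B\<in>M. A \<noteq> B \<longrightarrow>
        (\<exists>\<alpha>\<in>\<Phi>. mirror_separates v \<alpha> A B \<and>
           reflection \<alpha> <#\<^bsub>weyl_group \<Phi>\<^esub> A \<in> M \<and>
           reflection \<alpha> <#\<^bsub>weyl_group \<Phi>\<^esub> B \<in> M))"

section \<open>The root system $E_7$\<close>

text \<open>
  Bourbaki's realization inside $E_8$. Coordinates are indexed by the numeral type \<open>8\<close>, in which
  the index \<open>8\<close> is the element \<open>0\<close>.
\<close>

abbreviation \<epsilon> :: "8 \<Rightarrow> real^8" where
  "\<epsilon> i \<equiv> axis i 1"

definition E8_roots :: "(real^8) set" where
  "E8_roots =
     {a *\<^sub>R \<epsilon> i + b *\<^sub>R \<epsilon> j | a b i j. a \<in> {1, -1} \<and> b \<in> {1, -1} \<and> i \<noteq> j} \<union>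
     {x. (\<forall>i. x $ i \<in> {1/2, -1/2}) \<and> even (card {i. x $ i < 0})}"

definition E7_roots :: "(real^8) set" where
  "E7_roots = {\<alpha> \<in> E8_roots. \<alpha> \<bullet> (\<epsilon> 7 + \<epsilon> 8) = 0}"

text \<open>
  Bourbaki's simple roots \<open>\<alpha>\<^sub>1, \<dots>, \<alpha>\<^sub>7\<close>. The Dynkin diagram is the chain
  \<open>\<alpha>\<^sub>1 - \<alpha>\<^sub>3 - \<alpha>\<^sub>4 - \<alpha>\<^sub>5 - \<alpha>\<^sub>6 - \<alpha>\<^sub>7\<close> with \<open>\<alpha>\<^sub>2\<close> attached to \<open>\<alpha>\<^sub>4\<close>; the minuscule node is \<open>\<alpha>\<^sub>7\<close>.
\<close>

definition E7_simple_root :: "nat \<Rightarrow> real^8" where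
  "E7_simple_root k =
     [(1/2) *\<^sub>R (\<epsilon> 1 + \<epsilon> 8 - (\<epsilon> 2 + \<epsilon> 3 + \<epsilon> 4 + \<epsilon> 5 + \<epsilon> 6 + \<epsilon> 7)),
      \<epsilon> 1 + \<epsilon> 2, \<epsilon> 2 - \<epsilon> 1, \<epsilon> 3 - \<epsilon> 2, \<epsilon> 4 - \<epsilon> 3, \<epsilon> 5 - \<epsilon> 4, \<epsilon> 6 - \<epsilon> 5] ! (k - 1)"

abbreviation W_E7 :: "(real^8 \<Rightarrow> real^8) monoid" where
  "W_E7 \<equiv> weyl_group E7_roots"

definition E7_maximal_parabolic :: "nat \<Rightarrow> (real^8 \<Rightarrow> real^8) set" where
  "E7_maximal_parabolic k = reflection_subgroup (E7_simple_root ` ({1..7} - {k}))"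

abbreviation P7 :: "(real^8 \<Rightarrow> real^8) set" where
  "P7 \<equiv> E7_maximal_parabolic 7"

end

theory Submission
  imports Defs
begin

text \<open>
  The orbit of \<open>v\<close> consists, up to scaling, of the 56 minuscule weights, whose
  mutual inner products are \<open>3/2\<close>, \<open>1/2\<close>, \<open>-1/2\<close> and
  \<open>-3/2\<close>. Two weights with inner product \<open>1/2\<close> differ by a root,
  whose reflection exchanges them.

  If \<open>x \<bullet> y = -1/2\<close>, then \<open>x + y\<close> is a root, and the weights
  having inner product \<open>1\<close> with it are the vertices of a cross-polytope in which
  \<open>x\<close> and \<open>y\<close> are opposite. If the matroid contained no other
  opposite pair of this cross-polytope, then the segment from \<open>x\<close> to
  \<open>y\<close> would be an edge; so there is another pair \<open>x' + y' = x + y\<close>,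
  and the reflection in \<open>x - x'\<close> carries \<open>x, y\<close> to \<open>x',
  y'\<close>.

  If \<open>y = -x\<close>, any other antipodal pair in the matroid gives the reflection. That
  there is one follows from the previous case by a finite search: assume that \<open>x,
  -x\<close> is the only antipodal pair. By symmetry this pair and three further points can be
  normalized, and then the existence of second pairs \<open>x' + y' = x + y\<close> is applied
  repeatedly until every branch contains another antipodal pair.
\<close>

section \<open>Computations with coordinate lists\<close>

fun dot :: "int list \<Rightarrow> int list \<Rightarrow> int" where
  "dot (x # xs) (y # ys) = x * y + dot xs ys"
| "dot _ _ = 0"

abbreviation add :: "int list \<Rightarrow> int list \<Rightarrow> int list" where
  "add \<equiv> map2 (+)"

abbreviation sub :: "int list \<Rightarrow> int list \<Rightarrow> int list" where
  "sub \<equiv> map2 (-)"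

abbreviation neg :: "int list \<Rightarrow> int list" where
  "neg \<equiv> map uminus"

text \<open>
  Vectors are represented by lists of doubled coordinates, so that \<open>dot\<close> is four
  times the inner product. The weights below form the orbit of \<open>\<epsilon>\<^sub>6 +
  (\<epsilon>\<^sub>8 - \<epsilon>\<^sub>7) / 2\<close>, split as \<open>(12, 2) + (32,
  1)\<close> under \<open>D\<^sub>6 \<times> A\<^sub>1\<close>.
\<close>

definition weight_list :: "int list list" where
  "weight_list =
     concat (map (\<lambda>i. concat (map (\<lambda>a. map (\<lambda>h. (replicate 8 0)[i := a, 6 := - h, 7 := h])
       [1, -1]) [2, -2])) [0..<6]) @
     map (\<lambda>l. l @ [0, 0])
       (filter (\<lambda>l. even (length (filter (\<lambda>a. a < 0) l))) (List.n_lists 6 [1, -1]))"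

definition root_list :: "int list list" where
  "root_list = filter (\<lambda>l. l ! 6 + l ! 7 = 0)
     (concat (map (\<lambda>i. concat (map (\<lambda>j. concat (map (\<lambda>a. map (\<lambda>b. (replicate 8 0)[i := a, j := b])
        [2, -2]) [2, -2])) [0..<i])) [0..<8]) @
      filter (\<lambda>l. even (length (filter (\<lambda>a. a < 0) l))) (List.n_lists 8 [1, -1]))"

\<comment> \<open>The evaluated list becomes the code equation, so that later runs of
  \<open>code_simp\<close> do not rebuild the list from its description.\<close>
schematic_goal weight_list_eval [code]: "weight_list = ?l" by code_simp
schematic_goal root_list_eval [code]: "root_list = ?l" by code_simp

lemma weight_list_length: "\<forall>p\<in>set weight_list. length p = 8" by code_simp

lemma root_list_length: "\<forall>p\<in>set root_list. length p = 8" by code_simp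

lemma weight_list_dot:
  "\<forall>p\<in>set weight_list. \<forall>q\<in>set weight_list. (if p = q then dot p q = 6 else dot p q \<in> {2, -2, -6})"
  by code_simp

lemma root_list_dot: "\<forall>r\<in>set root_list. dot r r = 8" by code_simp

text \<open>
  Membership in the two lists is slow to evaluate symbolically; these tests are fast.
\<close>

definition is_weight :: "int list \<Rightarrow> bool" where
  "is_weight l \<longleftrightarrow> length l = 8 \<and> l ! 6 + l ! 7 = 0 \<and>
     (l ! 7 = 0 \<and> set (take 6 l) \<subseteq> {1, -1} \<and> even (length (filter (\<lambda>a. a < 0) (take 6 l))) \<or>
      l ! 7 \<in> {1, -1} \<and> set (take 6 l) \<subseteq> {0, 2, -2} \<and> length (filter (\<lambda>k. l ! k \<noteq> 0) [0..<6]) = 1)"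

definition is_root :: "int list \<Rightarrow> bool" where
  "is_root l \<longleftrightarrow> length l = 8 \<and> l ! 6 + l ! 7 = 0 \<and>
     (set l \<subseteq> {1, -1} \<and> even (length (filter (\<lambda>a. a < 0) l)) \<or>
      set l \<subseteq> {0, 2, -2} \<and> length (filter (\<lambda>k. l ! k \<noteq> 0) [0..<8]) = 2)"

lemma weight_list_sub:
  "\<forall>p\<in>set weight_list. \<forall>q\<in>set weight_list. dot p q = 2 \<longrightarrow>
     is_root (sub p q)"
  by code_simp

text \<open>Roots have norm 2, so the reflection in \<open>r\<close> subtracts the inner product
  times \<open>r\<close>; in doubled coordinates the value 4 stands for 1. That only 0, 1 and -1
  occur is the minuscule property.\<close>

lemma root_list_reflect:
  "\<forall>r\<in>set root_list. \<forall>p\<in>set weight_list. dot r p = 0 \<or>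
     (dot r p = 4 \<and> is_weight (sub p r)) \<or> (dot r p = -4 \<and> is_weight (add p r))"
  by code_simp

text \<open>
  If \<open>linked F p q\<close>, then at most two reflections in differences of weights carry
  \<open>p\<close> to \<open>q\<close>; they fix \<open>F\<close> pointwise since the weights
  involved have the same inner products with the members of \<open>F\<close>.
\<close>

definition linked :: "int list list \<Rightarrow> int list \<Rightarrow> int list \<Rightarrow> bool" where
  "linked F p q \<longleftrightarrow> (let C = filter (\<lambda>s. \<forall>f\<in>set F. dot s f = dot q f) weight_list in
     p \<in> set C \<and> (p = q \<or> dot p q = 2 \<or> (\<exists>s\<in>set C. dot p s = 2 \<and> dot s q = 2)))"

text \<open>
  The frame to which an arbitrary configuration is normalized; \<open>w = a + b + c\<close>
  and \<open>w - c = x + y\<close>.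
\<close>

definition pt_w :: "int list" where "pt_w = [0, 0, 0, 0, 0, 2, -1, 1]"
definition pt_a :: "int list" where "pt_a = [0, 0, 0, 0, 2, 0, -1, 1]"
definition pt_b :: "int list" where "pt_b = [0, 0, 0, 0, -2, 0, -1, 1]"
definition pt_c :: "int list" where "pt_c = [0, 0, 0, 0, 0, 2, 1, -1]"
definition pt_x :: "int list" where "pt_x = [2, 0, 0, 0, 0, 0, -1, 1]"
definition pt_y :: "int list" where "pt_y = [-2, 0, 0, 0, 0, 0, -1, 1]"

text \<open>In the graph of pairs with inner product 1/2 every weight except the antipode is at
  distance at most two from \<open>pt_w\<close>; the antipode is at distance three and hence
  exempted.\<close>

lemma linked_w: "\<forall>p\<in>set weight_list. p = neg pt_w \<or> linked [] p pt_w" by code_simp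

lemma linked_a:
  "\<forall>p\<in>set weight_list. dot p pt_w = 2 \<longrightarrow> linked [neg pt_w, pt_w] p pt_a"
  by code_simp

text \<open>The ten weights \<open>p\<close> in question are the vertices other than
  \<open>pt_a\<close> and \<open>neg pt_w\<close> of the cross-polytope of the root
  \<open>a - w\<close>; even opposite ones have a common neighbour among the ten.\<close>

lemma linked_b:
  "\<forall>p\<in>set weight_list. dot p pt_a = 2 \<longrightarrow> dot p (neg pt_w) = 2 \<longrightarrow>
     linked [pt_a, neg pt_w, pt_w] p (neg pt_b)"
  by code_simp

text \<open>In the cross-polytope of the root \<open>w - c\<close>, two opposite pairs are
  \<open>w\<close>, \<open>-c\<close> and \<open>a\<close>, \<open>b\<close>; the eight remaining
  vertices all have the same inner products with the frame.\<close>

lemma linked_x: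
  "\<forall>p\<in>set weight_list. dot p pt_w = 2 \<longrightarrow> dot p (neg pt_c) = 2 \<longrightarrow>
     p = pt_a \<or> p = pt_b \<or> linked [neg pt_c, neg pt_b, pt_a, neg pt_w, pt_w] p pt_x"
  by code_simp

text \<open>
  The second argument lists configurations contained in the set to be excluded, and the first
  one names, for each configuration in turn, the two positions of a pair \<open>x, y\<close>
  with \<open>x \<bullet> y = -1/2\<close> on which to branch. Branches that would create a
  second antipodal pair are dropped. The fixed vector is generic: it selects one member
  \<open>k\<close> of each pair \<open>k + k' = x + y\<close>.
\<close>

fun refutes :: "(nat \<times> nat) list \<Rightarrow> int list list list \<Rightarrow> bool" where
  "refutes _ [] = True"
| "refutes [] _ = False"
| "refutes ((i, j) # cs) (S # Ss) = (i < length S \<and> j < length S \<and> dot (S ! i) (S ! j) = - 2 \<and>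
     (let g = add (S ! i) (S ! j);
          N = map neg (filter (\<lambda>k. k \<noteq> pt_w \<and> k \<noteq> neg pt_w) S);
          ks = filter (\<lambda>k. dot k g = 4 \<and> k \<noteq> S ! i \<and> k \<noteq> S ! j \<and>
                 2 * dot k [1, 2, 4, 8, 16, 32, 0, 64] \<ge> dot g [1, 2, 4, 8, 16, 32, 0, 64] \<and>
                 k \<notin> set N \<and> sub g k \<notin> set N) weight_list
      in refutes cs (map (\<lambda>k. k # sub g k # S) ks @ Ss)))"

text \<open>The position pairs are consumed depth first. Each branch puts its two new points in
  front, so the older points move up by two positions.\<close>

lemma refutes_cert:
  "refutes
    [(0,5), (1,8), (1,9), (7,9), (0,3), (7,8), (1,8), (0,8), (7,9), (0,3), (7,8), (1,8), (0,8),
     (1,9), (7,9), (0,3), (7,8), (1,8), (0,8), (7,9), (0,3), (7,8), (1,8), (0,8), (1,9), (7,9),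
     (0,3), (7,8), (1,8), (0,8), (7,9), (0,3), (7,8), (1,8), (0,8), (1,8), (1,9), (7,9), (0,2),
     (7,8), (1,8), (0,8), (7,9), (0,3), (7,8), (1,8), (0,8), (1,9), (7,9), (0,2), (7,8), (1,8),
     (0,8), (7,9), (0,3), (7,8), (1,8), (0,8), (1,9), (7,9), (0,3), (7,8), (1,8), (0,8), (7,9),
     (0,3), (7,8), (1,8), (0,8), (1,8), (1,9), (7,9), (0,2), (7,8), (1,8), (0,8), (7,9), (0,3),
     (7,8), (1,8), (0,8), (1,9), (7,9), (0,2), (7,8), (1,8), (0,8), (7,9), (0,3), (7,8), (1,8),
     (0,8), (1,9), (7,9), (0,2), (7,8), (1,8), (0,8), (7,9), (0,3), (7,8), (1,8), (0,8), (1,8),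
     (1,9), (7,9), (0,2), (7,8), (1,8), (0,8), (7,9), (0,3), (7,8), (1,8), (0,8), (1,9), (7,9),
     (0,2), (7,8), (1,8), (0,8), (7,9), (0,3), (7,8), (1,8), (0,8), (1,9), (7,9), (0,2), (7,8),
     (1,8), (0,8), (7,9), (0,3), (7,8), (1,8), (0,8)]
    [[pt_y, pt_x, neg pt_c, neg pt_b, pt_a, neg pt_w, pt_w]]"
  by code_simp

section \<open>Weights and roots as vectors\<close>

text \<open>
  Position \<open>k\<close> of a list holds coordinate \<open>k + 1\<close>; position
  \<open>7\<close> is the index \<open>8 = 0\<close>.
\<close>

abbreviation idx :: "nat \<Rightarrow> 8" where "idx k \<equiv> of_nat (Suc k)"

lemma idx_bij: "bij_betw idx {..<8} UNIV"
proof -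
  have "{..<8::nat} = {0,1,2,3,4,5,6,7}" by auto
  then have "inj_on idx {..<8}" by (simp add: inj_on_def)
  moreover have "card (idx ` {..<8}) = card (UNIV :: 8 set)"
    using calculation by (simp add: card_image)
  then have "idx ` {..<8} = UNIV" by (intro card_subset_eq) auto
  ultimately show ?thesis by (simp add: bij_betw_def)
qed

lemma idx_eq_iff:
  "j < 8 \<Longrightarrow> k < 8 \<Longrightarrow> idx j = idx k \<longleftrightarrow> j = k"
  using idx_bij by (auto simp: bij_betw_def inj_on_def)

lemma idx_cases: obtains k where "k < 8" "i = idx k"
  using idx_bij by (force simp: bij_betw_def)

lemma vec8_eqI:
  "(\<And>k. k < 8 \<Longrightarrow> x $ idx k = y $ idx k) \<Longrightarrow> x = (y :: real^8)"
  by (metis idx_cases vec_eq_iff)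

definition half_vec :: "int list \<Rightarrow> real^8" where
  "half_vec l = (\<chi> i. real_of_int (l ! the_inv_into {..<8} idx i) / 2)"

lemma half_vec_nth: "k < 8 \<Longrightarrow> half_vec l $ idx k = real_of_int (l ! k) / 2"
proof -
  assume "k < 8"
  then have "the_inv_into {..<8} idx (idx k) = k"
    by (intro the_inv_into_f_f bij_betw_imp_inj_on[OF idx_bij]) auto
  then show ?thesis unfolding half_vec_def by (simp only: vec_lambda_beta)
qed

lemma half_vec_sub:
  "length l = 8 \<Longrightarrow> length m = 8 \<Longrightarrow>
     half_vec (sub l m) = half_vec l - half_vec m"
  by (rule vec8_eqI) (simp del: of_nat_Suc add: half_vec_nth diff_divide_distrib)

lemma half_vec_add:
  "length l = 8 \<Longrightarrow> length m = 8 \<Longrightarrow>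
     half_vec (add l m) = half_vec l + half_vec m"
  by (rule vec8_eqI) (simp del: of_nat_Suc add: half_vec_nth add_divide_distrib)

lemma half_vec_neg: "length l = 8 \<Longrightarrow> half_vec (neg l) = - half_vec l"
  by (rule vec8_eqI) (simp del: of_nat_Suc add: half_vec_nth)

lemma half_vec_inject:
  "length l = 8 \<Longrightarrow> length m = 8 \<Longrightarrow> half_vec l = half_vec m \<longleftrightarrow>
     l = m"
  by (metis (no_types, lifting) nth_equalityI half_vec_nth divide_cancel_right of_int_eq_iff zero_neq_numeral)

lemma dot_eq_sum:
  "length l = length m \<Longrightarrow> dot l m = (\<Sum>k<length l. l ! k * m ! k)"
  by (induction l m rule: dot.induct) (auto simp: sum.lessThan_Suc_shift simp del: sum.lessThan_Suc)

lemma inner_half_vec: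
  "length l = 8 \<Longrightarrow> length m = 8 \<Longrightarrow>
     half_vec l \<bullet> half_vec m = real_of_int (dot l m) / 4"
  unfolding inner_vec_def sum.reindex_bij_betw[OF idx_bij, symmetric]
  by (simp del: of_nat_Suc sum.lessThan_Suc add: half_vec_nth dot_eq_sum sum_divide_distrib)

lemma card_negative:
  "length l = 8 \<Longrightarrow>
     card {i. half_vec l $ i < 0} = length (filter (\<lambda>a. a < 0) l)"
proof -
  assume l: "length l = 8"
  have "{i. half_vec l $ i < 0} = idx ` {k. k < 8 \<and> l ! k < 0}"
  proof (intro Set.set_eqI iffI)
    fix i assume "i \<in> {i. half_vec l $ i < 0}"
    moreover obtain k where "k < 8" "i = idx k" by (rule idx_cases)
    ultimately show "i \<in> idx ` {k. k < 8 \<and> l ! k < 0}"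
      by (auto simp del: of_nat_Suc simp: half_vec_nth)
  qed (auto simp del: of_nat_Suc simp: half_vec_nth)
  moreover have "inj_on idx {k. k < 8 \<and> l ! k < 0}"
    using idx_eq_iff by (auto simp del: of_nat_Suc simp: inj_on_def)
  ultimately show ?thesis
    by (simp del: of_nat_Suc add: card_image length_filter_conv_card l)
qed

lemma inner_eps78: "x \<bullet> (\<epsilon> 7 + \<epsilon> 8) = x $ idx 6 + x $ idx 7"
  by (simp add: inner_add_right inner_axis)

lemma nth_scaled_axes:
  assumes "m < 8" "n < 8" "k < 8" 
  shows "(a *\<^sub>R \<epsilon> (idx m) + b *\<^sub>R \<epsilon> (idx n)) $ idx k = (if k = m then a else 0) + (if k = n then b else 0)"
  using assms idx_eq_iff by (simp del: of_nat_Suc add: axis_def)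

text \<open>Only this inclusion is stated through \<open>root_list\<close>; for the converse the
  test \<open>is_root\<close> is used, since that is what \<open>weight_list_sub\<close>
  supplies.\<close>

lemma E7_roots_vec:
  "\<alpha> \<in> E7_roots \<Longrightarrow> \<exists>r\<in>set root_list. \<alpha> = half_vec r"
proof -
  assume "\<alpha> \<in> E7_roots"
  then have E8: "\<alpha> \<in> E8_roots" and orth: "\<alpha> $ idx 6 + \<alpha> $ idx 7 = 0"
    unfolding E7_roots_def inner_eps78 by auto
  consider (int) a b i j where "\<alpha> = a *\<^sub>R \<epsilon> i + b *\<^sub>R \<epsilon> j" "a \<in> {1, -1}" "b \<in> {1, -1}" "i \<noteq> j"
    | (half) "\<forall>i. \<alpha> $ i \<in> {1/2, -1/2}" "even (card {i. \<alpha> $ i < 0})"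
    using E8 unfolding E8_roots_def by blast
  then show ?thesis
  proof cases
    case int
    \<comment> \<open>The enumeration in \<open>root_list\<close> has the second position below the
      first, so the two summands are swapped if necessary.\<close>
    obtain m n a b where mn: "n < m" "m < 8" "\<alpha> = a *\<^sub>R \<epsilon> (idx m) + b *\<^sub>R \<epsilon> (idx n)" and ab: "a \<in> {1, -1}" "b \<in> {1, -1}"
    proof -
      obtain m where m: "m < 8" "i = idx m" by (rule idx_cases)
      obtain n where n: "n < 8" "j = idx n" by (rule idx_cases)
      have "m \<noteq> n" using int m n by blast
      then show thesis
        using that[of n m a b] that[of m n b a] int m n by (cases "n < m") (auto simp del: of_nat_Suc simp: add.commute)
    qed
    obtain a' b' :: int where ab': "a = real_of_int a' / 2" "a' \<in> {2, -2}" "b = real_of_int b' / 2" "b' \<in> {2, -2}"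
      using ab by (intro that[of "if a = 1 then 2 else -2" "if b = 1 then 2 else -2"]) auto
    define r where "r = (replicate 8 (0::int))[m := a', n := b']"
    have \<alpha>: "\<alpha> = half_vec r"
      using mn(1,2) unfolding mn(3)
      by (intro vec8_eqI, subst nth_scaled_axes)
        (auto simp del: of_nat_Suc simp: half_vec_nth r_def nth_list_update ab')
    have "r ! 6 + r ! 7 = 0"
      using orth half_vec_nth[of 6 r] half_vec_nth[of 7 r] unfolding \<alpha> by simp
    moreover have "r \<in> set (concat (map (\<lambda>i. concat (map (\<lambda>j. concat (map (\<lambda>a. map (\<lambda>b. (replicate 8 0)[i := a, j := b]) [2, -2]) [2, -2])) [0..<i])) [0..<8]))"
      using mn(1,2) ab'(2,4) unfolding r_def set_concat set_map by fastforce
    ultimately show ?thesis using \<alpha> unfolding root_list_def by auto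
  next
    case half
    define r where "r = map (\<lambda>k. if \<alpha> $ idx k < 0 then -1 else (1::int)) [0..<8]"
    have len: "length r = 8" by (simp add: r_def)
    have \<alpha>: "\<alpha> = half_vec r"
    proof (rule vec8_eqI)
      fix k :: nat assume "k < 8"
      moreover have "\<alpha> $ idx k \<in> {1/2, -1/2}" using half by blast
      ultimately show "\<alpha> $ idx k = half_vec r $ idx k"
        by (auto simp del: of_nat_Suc simp: half_vec_nth r_def)
    qed
    have "r ! 6 + r ! 7 = 0"
      using orth half_vec_nth[of 6 r] half_vec_nth[of 7 r] unfolding \<alpha> by simp
    moreover have "even (length (filter (\<lambda>a. a < 0) r))"
      using half(2) card_negative[OF len] unfolding \<alpha> by simp
    moreover have "r \<in> set (List.n_lists 8 [1, -1])"
      using len by (auto simp: set_n_lists r_def)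
    ultimately show ?thesis using \<alpha> unfolding root_list_def by auto
  qed
qed

lemma half_vec_in_E7_roots: "is_root l \<Longrightarrow> half_vec l \<in> E7_roots"
proof -
  assume l: "is_root l"
  then have len: "length l = 8" and "l ! 6 + l ! 7 = 0" by (auto simp: is_root_def)
  then have "half_vec l \<bullet> (\<epsilon> 7 + \<epsilon> 8) = 0"
    using half_vec_nth[of 6 l] half_vec_nth[of 7 l] unfolding inner_eps78 by simp
  moreover have "half_vec l \<in> E8_roots"
  proof (cases "set l \<subseteq> {1, -1} \<and> even (length (filter (\<lambda>a. a < 0) l))")
    case True
    have "half_vec l $ i \<in> {1/2, -1/2}" for i
    proof -
      obtain k where k: "k < 8" "i = idx k" by (rule idx_cases)
      then have "l ! k \<in> set l" using len by simp
      then have "l ! k \<in> {1, -1}" using True by (elim conjE) (rule subsetD)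
      then show ?thesis unfolding k(2) half_vec_nth[OF k(1)] by auto
    qed
    then show ?thesis using True card_negative[OF len] unfolding E8_roots_def by auto
  next
    case False
    then have l2: "set l \<subseteq> {0, 2, -2}" "length (filter (\<lambda>k. l ! k \<noteq> 0) [0..<8]) = 2"
      using l by (auto simp: is_root_def)
    then obtain m n where mn: "filter (\<lambda>k. l ! k \<noteq> 0) [0..<8] = [m, n]"
      by (auto simp: length_Suc_conv numeral_2_eq_2)
    have "set (filter (\<lambda>k. l ! k \<noteq> 0) [0..<8]) = {m, n}" "distinct [m, n]"
      using mn distinct_filter[of "[0..<8]" "\<lambda>k. l ! k \<noteq> 0"] by (simp_all only: mn) auto
    then have nz: "k < 8 \<and> l ! k \<noteq> 0 \<longleftrightarrow> k = m \<or> k = n" and "m \<noteq> n" for k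
      by (auto simp: set_eq_iff)
    then have mn8: "m < 8" "l ! m \<noteq> 0" "n < 8" "l ! n \<noteq> 0" by blast+
    then have "l ! m \<in> set l" "l ! n \<in> set l" using len by simp_all
    with l2(1) have "l ! m \<in> {0, 2, -2}" "l ! n \<in> {0, 2, -2}" by (simp_all only: subset_iff)
    with mn8 have "l ! m \<in> {2, -2}" "l ! n \<in> {2, -2}" by simp_all
    moreover have "half_vec l = (real_of_int (l ! m) / 2) *\<^sub>R \<epsilon> (idx m) + (real_of_int (l ! n) / 2) *\<^sub>R \<epsilon> (idx n)"
      using nz \<open>m \<noteq> n\<close> mn8(1,3)
      by (intro vec8_eqI, subst nth_scaled_axes) (auto simp del: of_nat_Suc simp: half_vec_nth)
    moreover have "idx m \<noteq> idx n" using idx_eq_iff \<open>m \<noteq> n\<close> mn8(1,3) by blast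
    moreover have "real_of_int (l ! m) / 2 \<in> {1, -1}" "real_of_int (l ! n) / 2 \<in> {1, -1}"
      using calculation(1,2) by auto
    ultimately show ?thesis unfolding E8_roots_def by blast
  qed
  ultimately show ?thesis by (simp add: E7_roots_def)
qed

lemma is_weight_in_list: "is_weight l \<Longrightarrow> l \<in> set weight_list"
proof -
  assume l: "is_weight l"
  then have len: "length l = 8" and l6: "l ! 6 = - l ! 7" by (auto simp: is_weight_def)
  have split: "l = take 6 l @ [l ! 6, l ! 7]"
    using len by (intro nth_equalityI) (auto simp: nth_append nth_Cons' less_Suc_eq numeral_eq_Suc)
  show ?thesis
  proof (cases "l ! 7 = 0")
    case True
    then have "take 6 l \<in> set (filter (\<lambda>l. even (length (filter (\<lambda>a. a < 0) l))) (List.n_lists 6 [1, -1]))"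
      using l len by (auto simp: is_weight_def set_n_lists)
    then show ?thesis
      using split True l6 unfolding weight_list_def by auto
  next
    case False
    then have l2: "l ! 7 \<in> {1, -1}" "set (take 6 l) \<subseteq> {0, 2, -2}" "length (filter (\<lambda>k. l ! k \<noteq> 0) [0..<6]) = 1"
      using l by (auto simp: is_weight_def)
    then obtain i where "filter (\<lambda>k. l ! k \<noteq> 0) [0..<6] = [i]"
      by (auto simp: length_Suc_conv)
    then have "set (filter (\<lambda>k. l ! k \<noteq> 0) [0..<6]) = {i}" by simp
    then have nz: "k < 6 \<and> l ! k \<noteq> 0 \<longleftrightarrow> k = i" for k
      by (auto simp: set_eq_iff)
    then have i: "i < 6" "l ! i \<noteq> 0" by auto
    then have "l ! i \<in> set (take 6 l)" using len by (auto simp: in_set_conv_nth intro!: exI[of _ i])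
    with l2(2) i have li: "l ! i \<in> {2, -2}" by auto
    have "l = (replicate 8 0)[i := l ! i, 6 := - l ! 7, 7 := l ! 7]"
    proof (rule nth_equalityI)
      fix k assume "k < length l"
      then consider "k < 6" | "k = 6" | "k = 7" using len by linarith
      then show "l ! k = (replicate 8 0)[i := l ! i, 6 := - l ! 7, 7 := l ! 7] ! k"
        using nz[of k] i l6 by cases auto
    qed (simp add: len)
    then have "l \<in> set (concat (map (\<lambda>i. concat (map (\<lambda>a. map (\<lambda>h. (replicate 8 0)[i := a, 6 := - h, 7 := h]) [1, -1]) [2, -2])) [0..<6]))"
      using i(1) li l2(1) unfolding set_concat set_map by fastforce
    then show ?thesis unfolding weight_list_def by auto
  qed
qed

section \<open>The 56 minuscule weights and the action of the roots on them\<close>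

definition weights :: "(real^8) set" where "weights = half_vec ` set weight_list"

lemma weightsE: assumes "p \<in> weights" obtains l where "l \<in> set weight_list" "length l = 8" "p = half_vec l"
  using assms weight_list_length unfolding weights_def by blast

lemma weights_inner:
  "p \<in> weights \<Longrightarrow> q \<in> weights \<Longrightarrow>
     p = q \<and> p \<bullet> q = 3/2 \<or>
     p \<noteq> q \<and> p \<bullet> q \<in> {1/2, -1/2, -3/2}"
proof (elim weightsE)
  fix l m assume lm: "l \<in> set weight_list" "m \<in> set weight_list" "length l = 8" "length m = 8" "p = half_vec l" "q = half_vec m"
  then have "if l = m then dot l m = 6 else dot l m \<in> {2, -2, -6}" using weight_list_dot by blast
  then show ?thesis using lm by (auto simp: inner_half_vec half_vec_inject split: if_splits)
qed

lemma weights_diff: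
  "p \<in> weights \<Longrightarrow> q \<in> weights \<Longrightarrow> p \<bullet> q = 1/2 \<Longrightarrow>
     p - q \<in> E7_roots"
  by (elim weightsE) (use weight_list_sub in \<open>auto simp: inner_half_vec simp flip: half_vec_sub intro!: half_vec_in_E7_roots\<close>)

lemma E7_roots_norm: "\<alpha> \<in> E7_roots \<Longrightarrow> \<alpha> \<bullet> \<alpha> = 2"
  using E7_roots_vec root_list_dot root_list_length by (fastforce simp: inner_half_vec)

lemma E7_roots_weights:
  assumes "\<alpha> \<in> E7_roots" "p \<in> weights"
  shows "\<alpha> \<bullet> p \<in> {0, 1, -1}" "reflection \<alpha> p \<in> weights"
proof -
  obtain r where r: "r \<in> set root_list" "\<alpha> = half_vec r" "length r = 8" using assms E7_roots_vec root_list_length by blast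
  obtain l where l: "l \<in> set weight_list" "length l = 8" "p = half_vec l" using assms by (rule_tac weightsE)
  have eq: "reflection \<alpha> p = p - (\<alpha> \<bullet> p) *\<^sub>R \<alpha>"
    using E7_roots_norm[OF assms(1)] by (simp add: reflection_def)
  consider "dot r l = 0" | "dot r l = 4" "is_weight (sub l r)" | "dot r l = -4" "is_weight (add l r)"
    using root_list_reflect r l by blast
  then have "\<alpha> \<bullet> p \<in> {0, 1, -1} \<and> reflection \<alpha> p \<in> weights"
  proof cases
    case 1
    then show ?thesis using assms eq by (simp add: r l inner_half_vec)
  next
    case 2
    then show ?thesis using eq is_weight_in_list[OF 2(2)] by (auto simp: r l inner_half_vec half_vec_sub weights_def image_iff intro!: bexI)
  next
    case 3
    then show ?thesis using eq is_weight_in_list[OF 3(2)] by (auto simp: r l inner_half_vec half_vec_add weights_def image_iff intro!: bexI)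
  qed
  then show "\<alpha> \<bullet> p \<in> {0, 1, -1}" "reflection \<alpha> p \<in> weights" by auto
qed

section \<open>Sets of weights with short edges\<close>

text \<open>The supporting hyperplane cuts out a face, and a face of the hull is spanned by the
  points of \<open>X\<close> on it, here \<open>x\<close> and \<open>y\<close> alone.\<close>

lemma segment_edge_of_hull:
  fixes X :: "'a::euclidean_space set"
  assumes "finite X" "x \<in> X" "y \<in> X" "x \<noteq> y"
    and "u \<bullet> x = K" "u \<bullet> y = K" "\<And>z. z \<in> X \<Longrightarrow> z \<noteq> x \<Longrightarrow> z \<noteq> y \<Longrightarrow> u \<bullet> z < K"
  shows "convex hull {x, y} edge_of convex hull X"
proof -
  define F where "F = convex hull X \<inter> {z. u \<bullet> z = K}"
  have "convex hull X \<subseteq> {z. u \<bullet> z \<le> K}"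
  proof (intro hull_minimal convex_halfspace_le subsetI CollectI)
    fix z assume "z \<in> X"
    then show "u \<bullet> z \<le> K" using assms(5-7) by (cases "z = x \<or> z = y") (auto intro: less_imp_le)
  qed
  then have F: "F face_of convex hull X"
    unfolding F_def by (intro face_of_Int_supporting_hyperplane_le convex_convex_hull) auto
  obtain X' where X': "X' \<subseteq> X" "F = convex hull X'"
    by (rule face_of_convex_hull_subset[OF finite_imp_compact[OF assms(1)] F])
  have "X' \<subseteq> F" unfolding X'(2) by (rule hull_subset)
  then have "X' \<subseteq> {x, y}" using X'(1) assms(7) unfolding F_def by force
  moreover have "{x, y} \<subseteq> F"
    unfolding F_def using assms by (auto intro: hull_inc)
  then have "convex hull {x, y} \<subseteq> F"
    unfolding X'(2) by (intro hull_minimal convex_convex_hull)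
  moreover have "F \<subseteq> convex hull {x, y}"
    unfolding X'(2) by (rule hull_mono) fact
  ultimately have "F = convex hull {x, y}" by auto
  then show ?thesis
    using F assms(4) by (simp add: edge_of_def aff_dim_convex_hull aff_dim_2)
qed

text \<open>The only consequence of the edge condition that enters the finite search. The pair
  \<open>x'\<close>, \<open>y'\<close> is a second opposite pair in the cross-polytope of the root
  \<open>x + y\<close>.\<close>

definition exch :: "(real^8) set \<Rightarrow> bool" where
  "exch X \<longleftrightarrow> X \<subseteq> weights \<and> (\<forall>x\<in>X. \<forall>y\<in>X. x \<bullet> y = -1/2 \<longrightarrow>
     (\<exists>x'\<in>X. \<exists>y'\<in>X. x' + y' = x + y \<and> x' \<noteq> x \<and> x' \<noteq> y))"

text \<open>
  The matroid polytope is the convex hull of \<open>c *\<^sub>R X\<close> for a set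
  \<open>X\<close> of weights, where \<open>v\<close> is \<open>c\<close> times a weight;
  \<open>c\<close> may be negative.
\<close>

definition edges_short :: "real \<Rightarrow> (real^8) set \<Rightarrow> bool" where
  "edges_short c X \<longleftrightarrow> (\<forall>x\<in>X. \<forall>y\<in>X. x \<noteq> y \<longrightarrow>
     convex hull {c *\<^sub>R x, c *\<^sub>R y} edge_of convex hull ((*\<^sub>R) c ` X) \<longrightarrow> x \<bullet> y = 1/2)"

lemma finite_weights: "finite weights" by (simp add: weights_def)

lemma weights_neq_neg: "x \<in> weights \<Longrightarrow> x \<noteq> - x"
proof
  assume x: "x \<in> weights" "x = - x"
  have "x \<bullet> x = 3/2" using weights_inner[OF x(1,1)] by auto
  moreover have "x \<bullet> x = x \<bullet> (- x)" by (rule arg_cong[OF x(2), of "inner x"])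
  ultimately show False unfolding inner_minus_right by linarith
qed

lemma edges_shortD:
  assumes "edges_short c X" "c \<noteq> 0" "X \<subseteq> weights" "x \<in> X" "y \<in> X" "x \<noteq> y"
    and "u \<bullet> x = K" "u \<bullet> y = K" "\<And>z. z \<in> X \<Longrightarrow> z \<noteq> x \<Longrightarrow> z \<noteq> y \<Longrightarrow> u \<bullet> z < K"
  shows "x \<bullet> y = 1/2"
proof -
  \<comment> \<open>Dividing \<open>u\<close> by \<open>c\<close> compensates the scaling of the
    points, so the functional keeps its values even when \<open>c\<close> is negative.\<close>
  have "convex hull {c *\<^sub>R x, c *\<^sub>R y} edge_of convex hull ((*\<^sub>R) c ` X)"
    by (rule segment_edge_of_hull[where u = "(1/c) *\<^sub>R u" and K = K])
      (use assms finite_weights in \<open>auto intro: finite_subset\<close>)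
  then show ?thesis using assms by (simp add: edges_short_def)
qed

text \<open>Otherwise the whole polytope would be the segment between the two points, and the zero
  functional would exhibit it as an edge.\<close>

lemma edges_short_antipodal:
  assumes "edges_short c X" "c \<noteq> 0" "X \<subseteq> weights" "x \<in> X" "- x \<in> X"
  shows "\<exists>z\<in>X. z \<noteq> x \<and> z \<noteq> - x"
proof (rule ccontr)
  assume none: "\<not> ?thesis"
  have "x \<bullet> x = 3/2" using weights_inner[of x x] assms by auto
  moreover have "x \<noteq> - x" using weights_neq_neg assms by blast
  then have "x \<bullet> (- x) = 1/2"
    using none by (intro edges_shortD[OF assms, where u = 0 and K = 0]) auto
  ultimately show False by simp
qed

text \<open>
  With \<open>g = x + y\<close>, the centred vertices \<open>s - g/2\<close> of the
  cross-polytope that lie in \<open>X\<close> are orthonormal if no two of them are opposite;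
  \<open>u\<close> is their sum, and \<open>K *\<^sub>R g - u\<close> is maximal exactly at
  \<open>x\<close> and \<open>y\<close> for large \<open>K\<close>.
\<close>

lemma edges_short_exch:
  assumes "edges_short c X" "c \<noteq> 0" "X \<subseteq> weights"
  shows "exch X"
proof -
  {
    fix x y assume xy: "x \<in> X" "y \<in> X" "x \<bullet> y = -1/2"
      and none: "\<And>x' y'. x' \<in> X \<Longrightarrow> y' \<in> X \<Longrightarrow> x' + y' = x + y \<Longrightarrow> x' = x \<or> x' = y"
    note vals = weights_inner[OF subsetD[OF assms(3)] subsetD[OF assms(3)]]
    have x2: "x \<bullet> x = 3/2" and y2: "y \<bullet> y = 3/2" using vals[of x x] vals[of y y] xy by auto
    define g where "g = x + y"
    have g2: "g \<bullet> g = 2" by (simp add: g_def algebra_simps x2 y2 xy inner_commute[of y x])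
    have gx: "g \<bullet> x = 1" "g \<bullet> y = 1" by (simp_all add: g_def algebra_simps x2 y2 xy inner_commute[of y x])
    \<comment> \<open>A sum of two numbers from 1/2, -1/2, -3/2 is either 1 or at most 0.\<close>
    have gz: "g \<bullet> z = 1 \<or> g \<bullet> z \<le> 0" if "z \<in> X" for z
    proof (cases "z = x \<or> z = y")
      case False
      then have "x \<bullet> z \<in> {1/2, -1/2, -3/2}" "y \<bullet> z \<in> {1/2, -1/2, -3/2}"
        using vals[OF xy(1) that] vals[OF xy(2) that] by blast+
      then show ?thesis by (auto simp: g_def inner_add_left)
    qed (use gx in auto)
    define Z where "Z = {z \<in> X. g \<bullet> z = 1 \<and> z \<noteq> x \<and> z \<noteq> y}"
    have finZ: "finite Z" using finite_subset[OF assms(3) finite_weights] by (simp add: Z_def)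
    \<comment> \<open>The square of \<open>s + z - g\<close> is
      \<open>1 + 2 * (s \<bullet> z)\<close>: it vanishes at -1/2, which makes \<open>s\<close> and
      \<open>z\<close> opposite, and its nonnegativity excludes -3/2 in the next step.\<close>
    have antip: "s + z = g" if "s \<bullet> z = -1/2" "s \<in> X" "z \<in> X" "g \<bullet> s = 1" "g \<bullet> z = 1" for s z
    proof -
      have "(s + z - g) \<bullet> (s + z - g) = 0"
        using that g2 vals[of s s] vals[of z z] by (auto simp: algebra_simps inner_commute)
      then show ?thesis by simp
    qed
    have lower: "s \<bullet> z \<ge> -1/2" if "s \<in> X" "z \<in> X" "g \<bullet> s = 1" "g \<bullet> z = 1" for s z
    proof -
      have "0 \<le> (s + z - g) \<bullet> (s + z - g)" by simp
      then show ?thesis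
        using that g2 vals[of s s] vals[of z z] by (auto simp: algebra_simps inner_commute)
    qed
    have half: "s \<bullet> z = 1/2" if "s \<in> Z" "z \<in> X" "g \<bullet> z = 1" "s \<noteq> z" for s z
    proof -
      have s: "s \<in> X" "g \<bullet> s = 1" "s \<noteq> x" "s \<noteq> y" using that by (auto simp: Z_def)
      have "s \<bullet> z \<noteq> -1/2" using antip none s that unfolding g_def by blast
      then show ?thesis using vals[of s z] lower[of s z] s that by auto
    qed
    define u where "u = (\<Sum>s\<in>Z. s - (1/2) *\<^sub>R g)"
    have uz: "u \<bullet> z = (\<Sum>s\<in>Z. s \<bullet> z - g \<bullet> z / 2)" for z
      by (simp add: u_def inner_sum_left inner_diff_left)
    have ux: "u \<bullet> x = 0" "u \<bullet> y = 0"
      unfolding uz using half xy gx by (auto simp: Z_def intro!: sum.neutral)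
    have uZ: "u \<bullet> z = 1" if "z \<in> Z" for z
    proof -
      have z: "z \<in> X" "g \<bullet> z = 1" using that by (auto simp: Z_def)
      have "u \<bullet> z = (\<Sum>s\<in>Z. if s = z then 1 else 0)"
        unfolding uz using half z vals[of z z] by (intro sum.cong) auto
      then show ?thesis using that finZ by simp
    qed
    \<comment> \<open>\<open>K\<close> exceeds every value of \<open>u\<close> on \<open>X\<close>
      in modulus. On \<open>Z\<close> the functional \<open>K *\<^sub>R g - u\<close> takes the
      value \<open>K - 1\<close>; where \<open>g\<close> is at most 0 it is at most
      \<open>- (u \<bullet> z)\<close>.\<close>
    define K where "K = 1 + (\<Sum>z\<in>X. \<bar>u \<bullet> z\<bar>)"
    have bound: "\<bar>u \<bullet> z\<bar> < K" if "z \<in> X" for z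
      using member_le_sum[of z X "\<lambda>z. \<bar>u \<bullet> z\<bar>"] that finite_subset[OF assms(3) finite_weights] by (simp add: K_def)
    have "x \<bullet> y = 1/2"
    proof (rule edges_shortD[OF assms xy(1,2), where u = "K *\<^sub>R g - u" and K = K])
      show "x \<noteq> y" using xy x2 by auto
      fix z assume z: "z \<in> X" "z \<noteq> x" "z \<noteq> y"
      show "(K *\<^sub>R g - u) \<bullet> z < K"
      proof (cases "g \<bullet> z = 1")
        case True
        then have "z \<in> Z" using z by (simp add: Z_def)
        then show ?thesis using True uZ by (simp add: inner_diff_left)
      next
        case False
        then have "g \<bullet> z \<le> 0" using gz[OF z(1)] by auto
        moreover have "K > 0" using bound[OF z(1)] by linarith
        ultimately have "K * (g \<bullet> z) \<le> 0" by (simp add: mult_nonneg_nonpos)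
        then show ?thesis using bound[OF z(1)] by (simp add: inner_diff_left)
      qed
    qed (use gx ux in \<open>simp_all add: inner_diff_left\<close>)
    then have False using xy by simp
  }
  then show ?thesis using assms(3) unfolding exch_def by blast
qed

text \<open>Equal sums have equal norms, so \<open>x' \<bullet> y' = -1/2\<close> and
  \<open>x'\<close> has inner product 1 with \<open>x + y\<close>. Neither summand exceeds 1/2, so
  both equal 1/2.\<close>

lemma exch_neighbour:
  assumes "exch X" "x \<in> X" "y \<in> X" "x \<bullet> y = -1/2"
  obtains x' where "x' \<in> X" "x + y - x' \<in> X" "x' \<bullet> x = 1/2" "x' \<bullet> y = 1/2"
proof -
  obtain x' y' where *: "x' \<in> X" "y' \<in> X" "x' + y' = x + y" "x' \<noteq> x" "x' \<noteq> y"
    using assms unfolding exch_def by blast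
  have XW: "X \<subseteq> weights" using assms by (simp add: exch_def)
  note vals = weights_inner[OF subsetD[OF XW] subsetD[OF XW]]
  have sq: "z \<bullet> z = 3/2" if "z \<in> X" for z using vals[OF that that] by auto
  have sum2: "(a + b) \<bullet> (a + b) = 3 + 2 * (a \<bullet> b)" if "a \<in> X" "b \<in> X" for a b
    using sq[OF that(1)] sq[OF that(2)] by (simp add: inner_add_left inner_add_right inner_commute)
  have "x' \<bullet> y' = -1/2"
    using sum2[OF assms(2,3)] sum2[OF *(1,2)] *(3) assms(4) by simp
  then have "x' \<bullet> (x' + y') = 1" using sq[OF *(1)] by (simp add: inner_add_right)
  then have "x' \<bullet> x + x' \<bullet> y = 1" using * by (simp add: inner_add_right)
  then have "x' \<bullet> x = 1/2 \<and> x' \<bullet> y = 1/2" using vals[OF *(1) assms(2)] vals[OF *(1) assms(3)] *(4,5) by auto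
  moreover have "x + y - x' = y'" using * by (metis add_diff_cancel_left')
  ultimately show thesis using that * by metis
qed

definition lone_pair :: "(real^8) set \<Rightarrow> bool" where
  "lone_pair X \<longleftrightarrow> exch X \<and> (\<forall>x\<in>X. \<forall>y\<in>X. - x \<in> X \<longrightarrow> - y \<in> X \<longrightarrow> y = x \<or> y = - x)"

lemma lone_pair_unique:
  "lone_pair X \<Longrightarrow> x \<in> X \<Longrightarrow> - x \<in> X \<Longrightarrow> y \<in> X \<Longrightarrow> - y \<in> X \<Longrightarrow> y = x \<or> y = - x"
  unfolding lone_pair_def by blast

section \<open>Isometries preserving the weights\<close>

lemma linear_reflection: "linear (reflection \<alpha>)"
  by (rule linearI) (simp_all add: reflection_def algebra_simps add_divide_distrib)

lemma inner_reflection: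
  assumes "\<alpha> \<bullet> \<alpha> = 2"
  shows "reflection \<alpha> a \<bullet> reflection \<alpha> b = a \<bullet> b"
  using assms by (simp add: reflection_def inner_diff_left inner_diff_right inner_commute)

text \<open>The property is expressed by inner products, sums and negation, all of which
  \<open>g\<close> preserves; preserving norms makes \<open>g\<close> injective.\<close>

lemma lone_pair_image:
  assumes "linear g" "\<And>a b. g a \<bullet> g b = a \<bullet> b" "g ` weights \<subseteq> weights" "lone_pair X"
  shows "lone_pair (g ` X)"
proof -
  have inj: "g a = g b \<longleftrightarrow> a = b" for a b
  proof
    assume "g a = g b"
    then have "g (a - b) = 0" using assms(1) by (simp add: linear_diff)
    then have "(a - b) \<bullet> (a - b) = 0" using assms(2)[of "a - b" "a - b"] by simp
    then show "a = b" by simp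
  qed simp
  have mem: "g a \<in> g ` X \<longleftrightarrow> a \<in> X" for a using inj by auto
  note lin = linear_add[OF assms(1), symmetric] linear_neg[OF assms(1), symmetric]
  have "\<exists>x'\<in>g ` X. \<exists>y'\<in>g ` X. x' + y' = g x + g y \<and> x' \<noteq> g x \<and> x' \<noteq> g y"
    if xy: "x \<in> X" "y \<in> X" "x \<bullet> y = -1/2" for x y
  proof -
    obtain x' y' where "x' \<in> X" "y' \<in> X" "x' + y' = x + y" "x' \<noteq> x" "x' \<noteq> y"
      using assms(4) xy unfolding lone_pair_def exch_def by blast
    then show ?thesis by (intro bexI[of _ "g x'"] bexI[of _ "g y'"]) (auto simp: lin inj)
  qed
  moreover have "X \<subseteq> weights" using assms(4) by (simp add: lone_pair_def exch_def)
  then have "g ` X \<subseteq> weights" using assms(3) by blast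
  moreover have "g y = g x \<or> g y = - g x"
    if "x \<in> X" "y \<in> X" "- g x \<in> g ` X" "- g y \<in> g ` X" for x y
    using lone_pair_unique[OF assms(4), of x y] that by (simp add: lin inj mem)
  ultimately show ?thesis
    unfolding lone_pair_def exch_def by (auto simp: assms(2))
qed

text \<open>Here \<open>F\<close> is the part of the frame already in place, and \<open>g\<close> is
  kept as a linear isometry preserving the weights, the form that \<open>lone_pair_image\<close>
  takes.\<close>

definition moves :: "(real^8 \<Rightarrow> real^8) \<Rightarrow> (real^8) set \<Rightarrow> real^8 \<Rightarrow> real^8 \<Rightarrow> bool" where
  "moves g F p q \<longleftrightarrow> linear g \<and> (\<forall>a b. g a \<bullet> g b = a \<bullet> b) \<and> g ` weights \<subseteq> weights \<and> (\<forall>f\<in>F. g f = f) \<and> g p = q"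

lemma moves_trans:
  "moves g F p q \<Longrightarrow> moves h F q r \<Longrightarrow> moves (h \<circ> g) F p r"
  unfolding moves_def using linear_compose by (auto simp: image_subset_iff)

text \<open>The root \<open>p - q\<close> has inner product 1 with \<open>p\<close> and 0 with each
  \<open>f\<close> in \<open>F\<close>.\<close>

lemma moves_reflection:
  assumes "p \<in> weights" "q \<in> weights" "p \<bullet> q = 1/2" "\<And>f. f \<in> F \<Longrightarrow> f \<bullet> p = f \<bullet> q"
  shows "moves (reflection (p - q)) F p q"
proof -
  have root: "p - q \<in> E7_roots" using weights_diff assms by blast
  have refl: "reflection (p - q) x = x - ((p - q) \<bullet> x) *\<^sub>R (p - q)" for x
    using E7_roots_norm[OF root] by (simp add: reflection_def)
  have "reflection (p - q) a \<bullet> reflection (p - q) b = a \<bullet> b" for a b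
    by (rule inner_reflection) (simp add: E7_roots_norm[OF root])
  moreover have "reflection (p - q) ` weights \<subseteq> weights" using E7_roots_weights root by blast
  moreover have "reflection (p - q) f = f" if "f \<in> F" for f
    using assms(4)[OF that] by (simp add: refl inner_commute[of _ f] inner_diff_right)
  moreover have "(p - q) \<bullet> p = 1"
    using assms(3) weights_inner[OF assms(1,1)] by (auto simp: inner_diff_left inner_commute[of q p])
  then have "reflection (p - q) p = q" by (simp add: refl)
  ultimately show ?thesis unfolding moves_def using linear_reflection by blast
qed

lemma linked_moves:
  assumes "linked F p q" "q \<in> set weight_list" "set F \<subseteq> set weight_list"
  obtains g where "moves g (half_vec ` set F) (half_vec p) (half_vec q)"
proof -
  have step: "moves (reflection (half_vec s - half_vec t)) (half_vec ` set F) (half_vec s) (half_vec t)"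
    if "s \<in> set weight_list" "t \<in> set weight_list" "dot s t = 2" "\<forall>f\<in>set F. dot s f = dot t f" for s t
  proof (rule moves_reflection)
    fix f assume "f \<in> half_vec ` set F"
    then obtain l where l: "l \<in> set F" "f = half_vec l" by blast
    then have "length l = 8" using assms(3) weight_list_length by blast
    then show "f \<bullet> half_vec s = f \<bullet> half_vec t"
      using that weight_list_length l by (simp add: inner_half_vec inner_commute[of "half_vec l"])
  qed (use that weight_list_length in \<open>auto simp: weights_def inner_half_vec\<close>)
  consider "p = q" | "p \<in> set weight_list" "dot p q = 2" "\<forall>f\<in>set F. dot p f = dot q f"
    | s where "p \<in> set weight_list" "\<forall>f\<in>set F. dot p f = dot q f" "s \<in> set weight_list" "\<forall>f\<in>set F. dot s f = dot q f"
        "dot p s = 2" "dot s q = 2"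
    using assms(1) unfolding linked_def Let_def by auto
  then show thesis
  proof cases
    case 1
    then show thesis using that[of id] linear_id by (simp add: moves_def)
  next
    case 2
    then show thesis using that step assms(2) by blast
  next
    case 3
    then show thesis using that moves_trans[OF step[of p s] step[of s q]] assms(2) by simp
  qed
qed

section \<open>Normalization to the frame and the finite search\<close>

text \<open>The second point of a pair is determined by the sum: \<open>-c\<close> is the partner of
  \<open>-b\<close> in \<open>a - w\<close>, and in \<open>w - c\<close> the partner of
  \<open>x\<close> is \<open>y\<close> and that of \<open>a\<close> is \<open>b\<close>.\<close>

lemma frame_eqs:
  "half_vec pt_a - half_vec pt_w + half_vec pt_b = - half_vec pt_c"
  "half_vec pt_w - half_vec pt_c - half_vec pt_x = half_vec pt_y"
  "half_vec pt_w - half_vec pt_c - half_vec pt_a = half_vec pt_b"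
  "half_vec (neg pt_w) = - half_vec pt_w"
  "half_vec (neg pt_b) = - half_vec pt_b"
  "half_vec (neg pt_c) = - half_vec pt_c"
proof -
  have len: "length pt_w = 8" "length pt_a = 8" "length pt_b = 8" "length pt_c = 8" "length pt_x = 8"
    by (simp_all add: pt_w_def pt_a_def pt_b_def pt_c_def pt_x_def)
  show "half_vec (neg pt_w) = - half_vec pt_w" "half_vec (neg pt_b) = - half_vec pt_b" "half_vec (neg pt_c) = - half_vec pt_c"
    by (simp_all add: half_vec_neg len)
  have "half_vec (add (sub pt_a pt_w) pt_b) = half_vec (neg pt_c)"
       "half_vec (sub (sub pt_w pt_c) pt_x) = half_vec pt_y"
       "half_vec (sub (sub pt_w pt_c) pt_a) = half_vec pt_b"
    by (simp_all add: pt_w_def pt_a_def pt_b_def pt_c_def pt_x_def pt_y_def)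
  then show "half_vec pt_a - half_vec pt_w + half_vec pt_b = - half_vec pt_c"
    "half_vec pt_w - half_vec pt_c - half_vec pt_x = half_vec pt_y"
    "half_vec pt_w - half_vec pt_c - half_vec pt_a = half_vec pt_b"
    by (simp_all add: half_vec_sub half_vec_add half_vec_neg len)
qed

text \<open>Induction along the search. If the head configuration lies in \<open>X\<close>, then
  \<open>exch\<close> supplies a pair with sum \<open>g\<close>, one member of which survives the
  filter, so an extended configuration also lies in \<open>X\<close>.\<close>

lemma refutes_sound:
  assumes "lone_pair X" "half_vec pt_w \<in> X" "half_vec (neg pt_w) \<in> X"
  shows "refutes cs Ss \<Longrightarrow> S \<in> set Ss \<Longrightarrow> set S \<subseteq> set weight_list \<Longrightarrow> half_vec ` set S \<subseteq> X \<Longrightarrow> False"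
proof (induction cs Ss arbitrary: S rule: refutes.induct)
  case (3 i j cs S0 Ss)
  define g where "g = add (S0 ! i) (S0 ! j)"
  define N where "N = map neg (filter (\<lambda>k. k \<noteq> pt_w \<and> k \<noteq> neg pt_w) S0)"
  define G :: "int list" where "G = [1, 2, 4, 8, 16, 32, 0, 64]"
  define ks where "ks = filter (\<lambda>k. dot k g = 4 \<and> k \<noteq> S0 ! i \<and> k \<noteq> S0 ! j \<and>
    2 * dot k G \<ge> dot g G \<and> k \<notin> set N \<and> sub g k \<notin> set N) weight_list"
  have ij: "i < length S0" "j < length S0" "dot (S0 ! i) (S0 ! j) = -2"
    and rest: "refutes cs (map (\<lambda>k. k # sub g k # S0) ks @ Ss)"
    using "3.prems"(1) unfolding ks_def N_def G_def g_def by (simp_all add: Let_def)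
  note IH = "3.IH"[OF g_def N_def ks_def[unfolded G_def] rest]
  show False
  proof (cases "S = S0")
    case False
    then have "S \<in> set (map (\<lambda>k. k # sub g k # S0) ks @ Ss)" using 3 by simp
    then show False using IH 3 by blast
  next
    case True
    have XW: "X \<subseteq> weights" and ex: "exch X" using assms by (auto simp: lone_pair_def exch_def)
    note S = "3.prems"(3,4)[unfolded True]
    define x y where "x = S0 ! i" and "y = S0 ! j"
    have x: "x \<in> set weight_list" "half_vec x \<in> X" "length x = 8" and y: "y \<in> set weight_list" "half_vec y \<in> X" "length y = 8"
      using ij S weight_list_length unfolding x_def y_def by (auto simp: subset_iff)
    have g: "half_vec g = half_vec x + half_vec y" "length g = 8"
      unfolding g_def x_def[symmetric] y_def[symmetric] by (simp_all add: half_vec_add x y)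
    have "half_vec x \<bullet> half_vec y = -1/2" using ij x y by (simp add: inner_half_vec x_def y_def)
    then obtain x' where x': "x' \<in> X" "half_vec x + half_vec y - x' \<in> X" "x' \<bullet> half_vec x = 1/2" "x' \<bullet> half_vec y = 1/2"
      using exch_neighbour[OF ex x(2) y(2)] by blast
    obtain k where k: "k \<in> set weight_list" "length k = 8" "x' = half_vec k" using x' XW by (blast elim: weightsE)
    obtain m where m: "m \<in> set weight_list" "length m = 8" "half_vec x + half_vec y - x' = half_vec m" using x' XW by (blast elim: weightsE)
    have km: "half_vec k \<in> X" "half_vec m \<in> X" "half_vec k + half_vec m = half_vec g"
      using x' k m g by (auto simp: algebra_simps)
    have sub: "sub g k = m" "sub g m = k"
    proof -
      have "half_vec (sub g k) = half_vec m" "half_vec (sub g m) = half_vec k"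
        using km(3) g k m by (simp_all add: half_vec_sub algebra_simps flip: km(3))
      then show "sub g k = m" "sub g m = k" using g k m by (simp_all add: half_vec_inject)
    qed
    \<comment> \<open>A point of \<open>X\<close> in \<open>N\<close> would form a second antipodal
      pair with a point of the configuration.\<close>
    have notN: "l \<notin> set N" if "half_vec l \<in> X" for l
    proof
      assume "l \<in> set N"
      then obtain s where s: "s \<in> set S0" "s \<noteq> pt_w" "s \<noteq> neg pt_w" "l = neg s" by (auto simp: N_def)
      then have "length s = 8" "half_vec s \<in> X" using S weight_list_length by auto
      then have "- half_vec s \<in> X" using that s by (simp add: half_vec_neg)
      then have "half_vec s = half_vec pt_w \<or> half_vec s = half_vec (neg pt_w)"
        using lone_pair_unique[OF assms(1,2), of "half_vec s"] assms(3) \<open>half_vec s \<in> X\<close> unfolding frame_eqs by blast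
      then show False using s \<open>length s = 8\<close> by (simp add: half_vec_inject pt_w_def)
    qed
    have aux: "half_vec x \<bullet> half_vec x = 3/2" "half_vec y \<bullet> half_vec y = 3/2"
      using weights_inner[of "half_vec x" "half_vec x"] weights_inner[of "half_vec y" "half_vec y"] x y XW by auto
    have xyhalf: "half_vec x \<bullet> half_vec y = -1/2" by fact
    have mprod: "half_vec m \<bullet> half_vec x = 1/2" "half_vec m \<bullet> half_vec y = 1/2"
      using x'(3,4) aux xyhalf unfolding m(3)[symmetric]
      by (simp_all add: inner_diff_left inner_add_left inner_commute[of "half_vec y" "half_vec x"])
    have ok: "dot l g = 4 \<and> l \<noteq> x \<and> l \<noteq> y" if "l = k \<or> l = m" for l
    proof -
      have l: "half_vec l \<bullet> half_vec x = 1/2" "half_vec l \<bullet> half_vec y = 1/2" "length l = 8"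
        using that mprod x' k m by auto
      then have "half_vec l \<bullet> half_vec g = 1" by (simp add: g inner_add_right)
      then show ?thesis using l aux g(2) by (auto simp: inner_half_vec)
    qed
    \<comment> \<open>The larger of the products of \<open>k\<close> and \<open>m\<close> with
      \<open>G\<close> is at least half that of \<open>g\<close>, so at least one of the two passes
      the genericity test.\<close>
    have "half_vec g \<bullet> half_vec G = half_vec k \<bullet> half_vec G + half_vec m \<bullet> half_vec G"
      by (simp add: km(3)[symmetric] inner_add_left)
    then have "real_of_int (dot g G) = real_of_int (dot k G) + real_of_int (dot m G)"
      using g(2) k(2) m(2) by (simp add: inner_half_vec G_def)
    then have "dot g G \<le> 2 * dot k G \<or> dot g G \<le> 2 * dot m G" by linarith
    then have "\<exists>l\<in>{k, m}. l \<in> set ks"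
      using ok[of k] ok[of m] k m notN km sub unfolding ks_def x_def[symmetric] y_def[symmetric] by auto
    then obtain l where l: "l \<in> set ks" "l = k \<or> l = m" by blast
    then have "l # sub g l # S0 \<in> set (map (\<lambda>k. k # sub g k # S0) ks @ Ss)" by simp
    moreover have "set (l # sub g l # S0) \<subseteq> set weight_list" "half_vec ` set (l # sub g l # S0) \<subseteq> X"
      using l(2) sub k m km S by auto
    ultimately show False by (rule IH)
  qed
qed auto

lemma weight_list_frame:
  "set [pt_y, pt_x, neg pt_c, neg pt_b, pt_a, neg pt_w, pt_w] \<subseteq> set weight_list"
  by code_simp

lemma lone_pair_moves:
  "lone_pair X \<Longrightarrow> moves g F p q \<Longrightarrow> lone_pair (g ` X)"
  by (rule lone_pair_image) (auto simp: moves_def)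

text \<open>A third point produces the frame in four moves: the antipodal pair becomes
  \<open>w\<close>, \<open>-w\<close>; a neighbour of \<open>w\<close> becomes \<open>a\<close>; a
  second decomposition of \<open>a - w\<close> becomes \<open>-b\<close>, \<open>-c\<close>; one of
  \<open>w - c\<close> becomes \<open>x\<close>, \<open>y\<close>. Each move fixes the points placed
  before.\<close>

lemma lone_pair_only:
  assumes "lone_pair X" "x \<in> X" "- x \<in> X" "z \<in> X"
  shows "z = x \<or> z = - x"
proof (rule ccontr)
  assume neq: "\<not> ?thesis"
  let ?w = "half_vec pt_w" and ?a = "half_vec pt_a" and ?b = "half_vec pt_b" and ?c = "half_vec pt_c"
    and ?x = "half_vec pt_x"
  have inList: "pt_w \<in> set weight_list" "pt_a \<in> set weight_list" "neg pt_w \<in> set weight_list" "neg pt_b \<in> set weight_list" "neg pt_c \<in> set weight_list" "pt_x \<in> set weight_list" "pt_y \<in> set weight_list"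
    using weight_list_frame by auto
  have subW: "X \<subseteq> weights" if "lone_pair X" for X using that by (simp add: lone_pair_def exch_def)
  have dot2: "dot l m = 2" if "l \<in> set weight_list" "m \<in> set weight_list" "half_vec l \<bullet> half_vec m = 1/2" for l m
    using that weight_list_length by (simp add: inner_half_vec)
  \<comment> \<open>One of \<open>x\<close> and \<open>- x\<close> differs from the antipode of
    \<open>w\<close>, the exception in \<open>linked_w\<close>.\<close>
  obtain y where y: "y \<in> X" "- y \<in> X" "z \<noteq> y" "z \<noteq> - y" "y \<noteq> half_vec (neg pt_w)"
  proof (cases "x = half_vec (neg pt_w)")
    case True
    then show thesis using that[of "- x"] assms neq frame_eqs(4) weights_neq_neg[of ?w] inList
      by (auto simp: weights_def)
  qed (use that assms neq in auto)
  obtain p where p: "p \<in> set weight_list" "y = half_vec p" using y subW[OF assms(1)] by (blast elim: weightsE)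
  then have "p \<noteq> neg pt_w" using y(5) by auto
  then have "linked [] p pt_w" using linked_w p(1) by auto
  then obtain g where g: "moves g {} y ?w" using linked_moves[OF _ inList(1), of "[]" p] p by auto
  define X1 where "X1 = g ` X"
  have X1: "lone_pair X1" unfolding X1_def using lone_pair_moves assms g by blast
  have glin: "linear g" "g y = ?w" and gin: "\<And>a b. g a \<bullet> g b = a \<bullet> b" using g by (auto simp: moves_def)
  have w1: "?w \<in> X1" "- ?w \<in> X1"
    using y glin linear_neg[OF glin(1), of y] unfolding X1_def by (metis imageI)+
  have z1: "g z \<in> X1" using assms unfolding X1_def by blast
  have "z \<bullet> y \<in> {1/2, -1/2}"
  proof -
    have zy: "z \<in> weights" "y \<in> weights" "- y \<in> weights" using assms y subW by blast+
    have "z \<bullet> y \<noteq> -3/2"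
      using weights_inner[OF zy(1,3)] y(4) by auto
    then show ?thesis using weights_inner[OF zy(1,2)] y(3) by auto
  qed
  then have zw: "g z \<bullet> ?w \<in> {1/2, -1/2}" using gin[of z y] glin by simp
  \<comment> \<open>If the image of \<open>z\<close> is not itself a neighbour of \<open>w\<close>,
    its inner product with \<open>w\<close> is -1/2, and \<open>exch\<close> gives a common
    neighbour of both.\<close>
  obtain a1 where a1: "a1 \<in> X1" "a1 \<bullet> ?w = 1/2"
  proof (cases "g z \<bullet> ?w = 1/2")
    case False
    then have "g z \<bullet> ?w = -1/2" using zw by simp
    then show thesis
      using exch_neighbour[of X1 "g z" ?w] X1 z1 w1 that unfolding lone_pair_def by blast
  qed (use that z1 in blast)
  obtain pa where pa: "pa \<in> set weight_list" "a1 = half_vec pa" using a1 subW[OF X1] by (blast elim: weightsE)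
  then have "linked [neg pt_w, pt_w] pa pt_a" using linked_a dot2[OF pa(1) inList(1)] a1 by simp
  then obtain h where h: "moves h {- ?w, ?w} a1 ?a"
    using linked_moves[OF _ inList(2), of "[neg pt_w, pt_w]" pa] pa inList by (auto simp: frame_eqs)
  define X2 where "X2 = h ` X1"
  have X2: "lone_pair X2" unfolding X2_def using lone_pair_moves X1 h by blast
  have in2: "?w \<in> X2" "- ?w \<in> X2" "?a \<in> X2"
    using h w1 a1 unfolding X2_def moves_def by (metis imageI insertI1 insertI2)+
  have "?a \<bullet> - ?w = -1/2" using a1 h unfolding moves_def by (metis inner_minus_right insertI1 insertI2 minus_divide_left)
  then obtain b1 where b1: "b1 \<in> X2" "?a + - ?w - b1 \<in> X2" "b1 \<bullet> ?a = 1/2" "b1 \<bullet> - ?w = 1/2"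
    using exch_neighbour[of X2 ?a "- ?w"] X2 in2 unfolding lone_pair_def by blast
  obtain pb where pb: "pb \<in> set weight_list" "b1 = half_vec pb" using b1 subW[OF X2] by (blast elim: weightsE)
  then have "linked [pt_a, neg pt_w, pt_w] pb (neg pt_b)"
    using linked_b dot2[OF pb(1) inList(2)] dot2[OF pb(1) inList(3)] b1 by (simp add: frame_eqs)
  then obtain k where k: "moves k {?a, - ?w, ?w} b1 (- ?b)"
    using linked_moves[OF _ inList(4), of "[pt_a, neg pt_w, pt_w]" pb] pb inList by (auto simp: frame_eqs)
  define X3 where "X3 = k ` X2"
  have X3: "lone_pair X3" unfolding X3_def using lone_pair_moves X2 k by blast
  have kfix: "k ?a = ?a" "k (- ?w) = - ?w" "k ?w = ?w" "k b1 = - ?b" "linear k" using k by (auto simp: moves_def)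
  have "k (?a + - ?w - b1) = - ?c"
    by (simp only: linear_add[OF kfix(5)] linear_diff[OF kfix(5)] kfix) (use frame_eqs(1) in simp)
  then have in3: "?w \<in> X3" "- ?w \<in> X3" "?a \<in> X3" "- ?b \<in> X3" "- ?c \<in> X3"
    using in2 b1 kfix unfolding X3_def by (metis imageI)+
  have "dot pt_w (neg pt_c) = -2" by code_simp
  then have "?w \<bullet> half_vec (neg pt_c) = -1/2"
    by (subst inner_half_vec) (simp_all add: pt_w_def pt_c_def)
  then have "?w \<bullet> - ?c = -1/2" unfolding frame_eqs .
  then obtain x1 where x1: "x1 \<in> X3" "?w + - ?c - x1 \<in> X3" "x1 \<bullet> ?w = 1/2" "x1 \<bullet> - ?c = 1/2"
    using exch_neighbour[of X3 ?w "- ?c"] X3 in3 unfolding lone_pair_def by blast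
  \<comment> \<open>As \<open>-b\<close> is present, \<open>b\<close> would complete a second
    antipodal pair. This excludes \<open>x1 = b\<close>, and also \<open>x1 = a\<close>, whose
    partner is \<open>b\<close>.\<close>
  have "pt_b \<noteq> pt_w" "pt_b \<noteq> neg pt_w" "length pt_b = 8" "length pt_w = 8"
    by (simp_all add: pt_b_def pt_w_def)
  then have "?b \<noteq> ?w" "?b \<noteq> - ?w" by (simp_all add: half_vec_inject flip: frame_eqs(4))
  then have "?b \<notin> X3" using lone_pair_unique[OF X3 in3(1,2)] in3(4) by blast
  then have x1ab: "x1 \<noteq> ?a" "x1 \<noteq> ?b" using x1 frame_eqs(3) by auto
  obtain px where px: "px \<in> set weight_list" "x1 = half_vec px" using x1 subW[OF X3] by (blast elim: weightsE)
  then have "linked [neg pt_c, neg pt_b, pt_a, neg pt_w, pt_w] px pt_x"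
    using linked_x dot2[OF px(1) inList(1)] dot2[OF px(1) inList(5)] x1 x1ab by (auto simp: frame_eqs)
  then obtain m where m: "moves m {- ?c, - ?b, ?a, - ?w, ?w} x1 ?x"
    using linked_moves[OF _ inList(6), of "[neg pt_c, neg pt_b, pt_a, neg pt_w, pt_w]" px] px inList by (auto simp: frame_eqs)
  define X4 where "X4 = m ` X3"
  have X4: "lone_pair X4" unfolding X4_def using lone_pair_moves X3 m by blast
  have mfix: "m (- ?c) = - ?c" "m (- ?b) = - ?b" "m ?a = ?a" "m (- ?w) = - ?w" "m ?w = ?w" "m x1 = ?x" "linear m"
    using m by (auto simp: moves_def)
  have "m (?w + - ?c - x1) = half_vec pt_y"
    by (simp only: linear_add[OF mfix(7)] linear_diff[OF mfix(7)] mfix) (use frame_eqs(2) in simp)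
  then have in4: "?w \<in> X4" "- ?w \<in> X4" "?a \<in> X4" "- ?b \<in> X4" "- ?c \<in> X4" "?x \<in> X4" "half_vec pt_y \<in> X4"
    using in3 x1 mfix unfolding X4_def by (metis imageI)+
  show False
    by (rule refutes_sound[OF X4 _ _ refutes_cert _ weight_list_frame]) (use in4 in \<open>auto simp: frame_eqs\<close>)
qed

section \<open>Strong exchange for points\<close>

lemma reflection_exchange:
  assumes "x \<in> weights" "a \<in> weights" "x \<bullet> a = 1/2"
  shows "x - a \<in> E7_roots" "(x - a) \<bullet> x = 1" "reflection (x - a) x = a"
    "(x - a) \<bullet> y = -1 \<Longrightarrow> reflection (x - a) y = x + y - a"
proof -
  show root: "x - a \<in> E7_roots" using weights_diff assms by blast
  show 1: "(x - a) \<bullet> x = 1"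
    using assms(3) weights_inner[OF assms(1,1)] by (auto simp: inner_diff_left inner_commute[of a x])
  show "reflection (x - a) x = a" "(x - a) \<bullet> y = -1 \<Longrightarrow> reflection (x - a) y = x + y - a"
    using E7_roots_norm[OF root] 1 by (simp_all add: reflection_def)
qed

lemma exchange_points:
  assumes "edges_short c X" "c \<noteq> 0" "X \<subseteq> weights" "x \<in> X" "y \<in> X" "x \<noteq> y"
  shows "\<exists>\<alpha>\<in>E7_roots. \<alpha> \<bullet> x = 1 \<and> \<alpha> \<bullet> y = -1 \<and> reflection \<alpha> x \<in> X \<and> reflection \<alpha> y \<in> X"
proof -
  have ex: "exch X" using edges_short_exch assms by blast
  have xyW: "x \<in> weights" "y \<in> weights" using assms by auto
  \<comment> \<open>The reflection in \<open>x - a\<close> takes \<open>x\<close> to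
    \<open>a\<close> and \<open>y\<close> to \<open>x + y - a\<close>; each case below only has to
    supply \<open>a\<close>.\<close>
  have main: ?thesis if "a \<in> X" "x \<bullet> a = 1/2" "(x - a) \<bullet> y = -1" "x + y - a \<in> X" for a
    using reflection_exchange(1-3)[of x a] reflection_exchange(4)[of x a y] that xyW assms by (intro bexI[of _ "x - a"]) auto
  consider "x \<bullet> y = 1/2" | "x \<bullet> y = -1/2" | "x \<bullet> y = -3/2" using weights_inner[OF xyW] assms by auto
  then show ?thesis
  proof cases
    case 1
    then show ?thesis using main[of y] assms weights_inner[OF xyW(2,2)] by (auto simp: inner_diff_left)
  next
    case 2
    then obtain x' where "x' \<in> X" "x + y - x' \<in> X" "x' \<bullet> x = 1/2" "x' \<bullet> y = 1/2"
      using exch_neighbour[OF ex assms(4,5)] by blast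
    moreover have "(x - x') \<bullet> y = -1" using calculation 2 by (simp add: inner_diff_left)
    ultimately show ?thesis using main[of x'] by (simp add: inner_commute)
  next
    case 3
    have "(x + y) \<bullet> (x + y) = 0"
      using 3 weights_inner[OF xyW(1,1)] weights_inner[OF xyW(2,2)] by (auto simp: inner_add_left inner_add_right inner_commute)
    then have y: "y = - x" by (simp add: eq_neg_iff_add_eq_0 add.commute)
    obtain z where "z \<in> X" "z \<noteq> x" "z \<noteq> - x"
      using edges_short_antipodal[OF assms(1-4)] assms(5) y by auto
    then have "\<not> lone_pair X" using lone_pair_only assms(4,5) y by blast
    then obtain a b where ab: "a \<in> X" "- a \<in> X" "b \<in> X" "- b \<in> X" "b \<noteq> a" "b \<noteq> - a"
      using ex unfolding lone_pair_def by blast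
    \<comment> \<open>Of two distinct antipodal pairs at least one differs from the pair
      \<open>x\<close>, \<open>- x\<close>. One of its members is a neighbour \<open>e\<close> of
      \<open>x\<close>, and \<open>x + y - e\<close> is \<open>- e\<close>.\<close>
    obtain d where d: "d \<in> X" "- d \<in> X" "d \<noteq> x" "d \<noteq> - x"
      using ab by (metis minus_minus)
    have dW: "d \<in> weights" "- d \<in> weights" using d assms by auto
    have "x \<bullet> d = 1/2 \<or> x \<bullet> - d = 1/2"
      using weights_inner[OF xyW(1) dW(1)] weights_inner[OF xyW(1) dW(2)] d by auto
    then obtain e where e: "e \<in> X" "- e \<in> X" "x \<bullet> e = 1/2" using d by (metis minus_minus)
    have "(x - e) \<bullet> y = -1"
      using reflection_exchange(2)[of x e] e xyW assms by (auto simp: y)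
    then show ?thesis using main[of e] e y by simp
  qed
qed

section \<open>The Weyl group and its cosets\<close>

lemma reflection_reflection: "reflection \<alpha> (reflection \<alpha> x) = x"
  by (cases "\<alpha> = 0") (simp_all add: reflection_def inner_diff_right)

lemma Bij_UNIV_iff: "f \<in> Bij UNIV \<longleftrightarrow> bij f"
  by (simp add: Bij_def)

lemma reflection_in_Bij: "reflection \<alpha> \<in> carrier (BijGroup UNIV)"
  unfolding BijGroup_def Bij_UNIV_iff partial_object.simps
  by (rule o_bij[of "reflection \<alpha>"]) (auto simp: reflection_reflection)

lemma mult_BijGroup_UNIV:
  "f \<in> carrier (BijGroup UNIV) \<Longrightarrow> g \<in> carrier (BijGroup UNIV) \<Longrightarrow> f \<otimes>\<^bsub>BijGroup UNIV\<^esub> g = f \<circ> g"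
  by (auto simp: BijGroup_def compose_def)

lemma one_BijGroup_UNIV: "\<one>\<^bsub>BijGroup UNIV\<^esub> = id"
  by (auto simp: BijGroup_def)

lemma inv_reflection: "inv\<^bsub>BijGroup UNIV\<^esub> reflection \<alpha> = reflection \<alpha>"
proof -
  interpret group "BijGroup UNIV" by (rule group_BijGroup)
  show ?thesis
    by (rule inv_equality)
      (auto simp: mult_BijGroup_UNIV one_BijGroup_UNIV reflection_in_Bij reflection_reflection)
qed

lemma reflection_subgroup_subgroup: "subgroup (reflection_subgroup S) (BijGroup UNIV)"
  unfolding reflection_subgroup_def
  by (rule group.generate_is_subgroup[OF group_BijGroup]) (use reflection_in_Bij in blast)

text \<open>Reflections are involutions, so inverses of generators fall under the case
  \<open>refl\<close>.\<close>

lemma reflection_subgroup_induct [consumes 1, case_names id refl comp]: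
  assumes "\<sigma> \<in> reflection_subgroup S"
    and "P id" "\<And>\<alpha>. \<alpha> \<in> S \<Longrightarrow> P (reflection \<alpha>)" "\<And>f g. P f \<Longrightarrow> P g \<Longrightarrow> P (f \<circ> g)"
  shows "P \<sigma>"
  using assms(1) unfolding reflection_subgroup_def
proof (induction rule: generate.induct)
  case (eng f g)
  then have "f \<in> carrier (BijGroup UNIV)" "g \<in> carrier (BijGroup UNIV)"
    using reflection_subgroup_subgroup[of S] subgroup.subset unfolding reflection_subgroup_def by blast+
  then show ?case using assms(4)[OF eng.IH] by (simp only: mult_BijGroup_UNIV)
next
  case one
  show ?case unfolding one_BijGroup_UNIV by (rule assms(2))
qed (auto simp: inv_reflection assms(3))

lemma group_weyl_group: "group (weyl_group S)"
  unfolding weyl_group_def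
  by (rule subgroup.subgroup_is_group[OF reflection_subgroup_subgroup group_BijGroup])

lemma carrier_weyl_group: "carrier (weyl_group S) = reflection_subgroup S"
  by (simp add: weyl_group_def)

lemma mult_weyl_group:
  assumes "f \<in> carrier (weyl_group S)" "g \<in> carrier (weyl_group S)"
  shows "f \<otimes>\<^bsub>weyl_group S\<^esub> g = f \<circ> g"
proof -
  have "f \<in> carrier (BijGroup UNIV)" "g \<in> carrier (BijGroup UNIV)"
    using assms subgroup.subset[OF reflection_subgroup_subgroup[of S]] by (auto simp: carrier_weyl_group)
  then show ?thesis by (simp add: weyl_group_def mult_BijGroup_UNIV)
qed

lemma one_weyl_group: "\<one>\<^bsub>weyl_group S\<^esub> = id"
  by (simp add: weyl_group_def one_BijGroup_UNIV)

lemma reflection_in_subgroup: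
  "\<alpha> \<in> S \<Longrightarrow> reflection \<alpha> \<in> reflection_subgroup S"
  unfolding reflection_subgroup_def by (intro generate.incl) blast

text \<open>The cosets of a stabilizer are the fibres of evaluation at \<open>v\<close>; this is the
  identification of cosets with points of the orbit.\<close>

lemma weyl_coset_eq:
  assumes "\<sigma> \<in> carrier (weyl_group S)" "P = stabilizer (weyl_group S) (\<lambda>\<sigma>. \<sigma>) v"
  shows "\<sigma> <#\<^bsub>weyl_group S\<^esub> P = {\<rho> \<in> carrier (weyl_group S). \<rho> v = \<sigma> v}"
proof -
  interpret group "weyl_group S" by (rule group_weyl_group)
  have P: "P = {\<rho> \<in> carrier (weyl_group S). \<rho> v = v}"
    unfolding assms(2) stabilizer_def by simp
  show ?thesis
  proof (intro subset_antisym subsetI)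
    fix \<rho> assume "\<rho> \<in> \<sigma> <#\<^bsub>weyl_group S\<^esub> P"
    then obtain \<pi> where \<pi>: "\<pi> \<in> carrier (weyl_group S)" "\<pi> v = v" "\<rho> = \<sigma> \<otimes>\<^bsub>weyl_group S\<^esub> \<pi>"
      unfolding l_coset_def P by blast
    then show "\<rho> \<in> {\<rho> \<in> carrier (weyl_group S). \<rho> v = \<sigma> v}"
      using assms(1) m_closed[OF assms(1) \<pi>(1)] mult_weyl_group[OF assms(1) \<pi>(1)] by simp
  next
    fix \<rho> assume "\<rho> \<in> {\<rho> \<in> carrier (weyl_group S). \<rho> v = \<sigma> v}"
    then have \<rho>: "\<rho> \<in> carrier (weyl_group S)" "\<rho> v = \<sigma> v" by auto
    define \<tau> where "\<tau> = inv\<^bsub>weyl_group S\<^esub> \<sigma>"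
    have \<tau>: "\<tau> \<in> carrier (weyl_group S)" unfolding \<tau>_def using assms(1) by (rule inv_closed)
    have "\<tau> \<otimes>\<^bsub>weyl_group S\<^esub> \<sigma> = \<one>\<^bsub>weyl_group S\<^esub>" "\<sigma> \<otimes>\<^bsub>weyl_group S\<^esub> \<tau> = \<one>\<^bsub>weyl_group S\<^esub>"
      unfolding \<tau>_def using assms(1) by simp_all
    then have comp: "\<tau> \<circ> \<sigma> = id" "\<sigma> \<circ> \<tau> = id"
      using mult_weyl_group[OF \<tau> assms(1)] mult_weyl_group[OF assms(1) \<tau>] by (simp_all add: one_weyl_group)
    have "(\<tau> \<circ> \<rho>) v = v" using \<rho>(2) fun_cong[OF comp(1), of v] by simp
    then have "\<tau> \<otimes>\<^bsub>weyl_group S\<^esub> \<rho> \<in> P"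
      using m_closed[OF \<tau> \<rho>(1)] mult_weyl_group[OF \<tau> \<rho>(1)] unfolding P by simp
    moreover have "\<rho> = \<sigma> \<otimes>\<^bsub>weyl_group S\<^esub> (\<tau> \<otimes>\<^bsub>weyl_group S\<^esub> \<rho>)"
      using assms(1) \<rho>(1) \<tau> by (simp add: \<tau>_def flip: m_assoc)
    ultimately show "\<rho> \<in> \<sigma> <#\<^bsub>weyl_group S\<^esub> P" unfolding l_coset_def by blast
  qed
qed

lemma weyl_group_E7_weights:
  assumes "\<sigma> \<in> carrier W_E7"
  shows "linear \<sigma>" "x \<in> weights \<Longrightarrow> \<sigma> x \<in> weights"
proof -
  have "linear \<sigma> \<and> \<sigma> ` weights \<subseteq> weights"
    using assms unfolding carrier_weyl_group
  proof (induction rule: reflection_subgroup_induct)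
    case (refl \<alpha>)
    then show ?case using linear_reflection E7_roots_weights(2) by blast
  next
    case (comp f g)
    then show ?case using linear_compose[of g f] by (auto simp: image_subset_iff o_def)
  qed (use linear_id in \<open>auto simp: id_def\<close>)
  then show "linear \<sigma>" "x \<in> weights \<Longrightarrow> \<sigma> x \<in> weights" by auto
qed

section \<open>The point stabilized by the parabolic subgroup\<close>

lemma reflection_fixes_iff:
  "\<alpha> \<noteq> 0 \<Longrightarrow> reflection \<alpha> x = x \<longleftrightarrow>
     \<alpha> \<bullet> x = 0"
  by (simp add: reflection_def)

text \<open>The equations force the first five coordinates to vanish and the last two to be minus
  and plus half of the sixth.\<close>

lemma E7_weight_components:
  fixes x :: "real^8"
  assumes "\<And>k. k \<in> {1..6} \<Longrightarrow> E7_simple_root k \<bullet> x = 0" "x $ 7 + x $ 8 = 0"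
  shows "x = x $ 6 *\<^sub>R half_vec pt_w"
proof -
  have "E7_simple_root 1 \<bullet> x = 0" "E7_simple_root 2 \<bullet> x = 0" "E7_simple_root 3 \<bullet> x = 0"
    "E7_simple_root 4 \<bullet> x = 0" "E7_simple_root 5 \<bullet> x = 0" "E7_simple_root 6 \<bullet> x = 0"
    using assms(1) by auto
  then have eqs: "x $ 1 + x $ 8 - (x $ 2 + x $ 3 + x $ 4 + x $ 5 + x $ 6 + x $ 7) = 0"
    "x $ 1 + x $ 2 = 0" "x $ 2 = x $ 1" "x $ 3 = x $ 2" "x $ 4 = x $ 3" "x $ 5 = x $ 4"
    unfolding E7_simple_root_def
    by (simp_all add: numeral_eq_Suc inner_add_left inner_diff_left inner_axis' nth_Cons')
  show ?thesis
  proof (rule vec8_eqI)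
    fix k :: nat assume "k < 8"
    then consider "k = 0" | "k = 1" | "k = 2" | "k = 3" | "k = 4" | "k = 5" | "k = 6" | "k = 7" by linarith
    then show "x $ idx k = (x $ 6 *\<^sub>R half_vec pt_w) $ idx k"
      unfolding vector_scaleR_component half_vec_nth[OF \<open>k < 8\<close>]
      using eqs assms(2) by cases (auto simp: pt_w_def)
  qed
qed

text \<open>The reflections in the first six simple roots fix \<open>v\<close>, so \<open>v\<close>
  is a multiple of the seventh fundamental weight. The multiple is nonzero: the whole Weyl group
  fixes 0, whereas \<open>P7\<close> fixes that weight and the seventh simple reflection moves
  it.\<close>

lemma stabilizer_weight:
  assumes "v \<in> span E7_roots" "stabilizer W_E7 (\<lambda>\<sigma>. \<sigma>) v = P7"
  obtains c where "c \<noteq> 0" "v = c *\<^sub>R half_vec pt_w"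
proof
  have "span E7_roots \<subseteq> {x. x \<bullet> (\<epsilon> 7 + \<epsilon> 8) = 0}"
    by (intro span_minimal) (auto simp: E7_roots_def subspace_def inner_add_left)
  then have v78: "v $ 7 + v $ 8 = 0"
    using assms(1) by (auto simp: inner_add_right inner_axis)
  have nz: "E7_simple_root k \<bullet> E7_simple_root k = 2" if "k \<in> {1..7}" for k
  proof -
    have "k = 1 \<or> k = 2 \<or> k = 3 \<or> k = 4 \<or> k = 5 \<or> k = 6 \<or> k = 7" using that by (simp, linarith)
    then show ?thesis
      unfolding E7_simple_root_def
      by (auto simp: numeral_eq_Suc inner_add_left inner_diff_left inner_add_right inner_diff_right inner_axis_axis axis_eq_axis)
  qed
  have P7_refl: "reflection (E7_simple_root k) \<in> P7" if "k \<in> {1..6}" for k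
    unfolding E7_maximal_parabolic_def using that by (intro reflection_in_subgroup) auto
  have v_orth: "E7_simple_root k \<bullet> v = 0" if "k \<in> {1..6}" for k
  proof -
    have "reflection (E7_simple_root k) v = v"
      using P7_refl[OF that] unfolding assms(2)[symmetric] stabilizer_def by simp
    moreover have "E7_simple_root k \<noteq> 0" using nz[of k] that by auto
    ultimately show ?thesis using reflection_fixes_iff by blast
  qed
  show v: "v = v $ 6 *\<^sub>R half_vec pt_w"
    by (rule E7_weight_components[OF v_orth v78])
  show "v $ 6 \<noteq> 0"
  proof
    assume "v $ 6 = 0"
    then have "v = 0" using v by simp
    \<comment> \<open>This is the seventh simple root \<open>\<epsilon> 6 - \<epsilon> 5\<close> in
      doubled coordinates.\<close>
    have root: "half_vec [0, 0, 0, 0, -2, 2, 0, 0] \<in> E7_roots" (is "?r \<in> _")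
      by (rule half_vec_in_E7_roots) code_simp
    then have "reflection ?r \<in> P7"
      unfolding assms(2)[symmetric] stabilizer_def carrier_weyl_group
      using \<open>v = 0\<close> reflection_in_subgroup by (auto simp: reflection_def)
    moreover have "\<sigma> (half_vec pt_w) = half_vec pt_w" if "\<sigma> \<in> P7" for \<sigma>
      using that unfolding E7_maximal_parabolic_def
    proof (induction rule: reflection_subgroup_induct)
      case (refl \<alpha>)
      then obtain k where "k \<in> {1..7} - {7}" and \<alpha>: "\<alpha> = E7_simple_root k" by blast
      then have "1 \<le> k" "k \<le> 6" by auto
      then have k: "k = 1 \<or> k = 2 \<or> k = 3 \<or> k = 4 \<or> k = 5 \<or> k = 6" by linarith
      have "half_vec pt_w $ 1 = 0" "half_vec pt_w $ 2 = 0" "half_vec pt_w $ 3 = 0" "half_vec pt_w $ 4 = 0"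
        "half_vec pt_w $ 5 = 0" "half_vec pt_w $ 6 = 1" "half_vec pt_w $ 7 = -1/2" "half_vec pt_w $ 8 = 1/2"
        using half_vec_nth[of 0 pt_w] half_vec_nth[of 1 pt_w] half_vec_nth[of 2 pt_w] half_vec_nth[of 3 pt_w]
          half_vec_nth[of 4 pt_w] half_vec_nth[of 5 pt_w] half_vec_nth[of 6 pt_w] half_vec_nth[of 7 pt_w]
        by (simp_all add: pt_w_def)
      then have "\<alpha> \<bullet> half_vec pt_w = 0"
        using k unfolding \<alpha> E7_simple_root_def
        by (auto simp: numeral_eq_Suc inner_add_left inner_diff_left inner_axis' nth_Cons')
      then show ?case by (simp add: reflection_def)
    qed auto
    ultimately have "reflection ?r (half_vec pt_w) = half_vec pt_w" by blast
    moreover have "?r \<noteq> 0" using E7_roots_norm[OF root] by auto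
    ultimately have "?r \<bullet> half_vec pt_w = 0" using reflection_fixes_iff by blast
    then show False by (simp add: inner_half_vec pt_w_def)
  qed
qed

text \<open>If \<open>x - y\<close> is \<open>s\<close> times a root, then \<open>2 * s\<close> is a
  difference of two numbers from 0, 1, -1, so the squared distance is 0, 1/2 or 2. Distinct weights
  have squared distance 2, 4 or 6, which leaves 2.\<close>

lemma parallel_segment_inner:
  assumes "x \<in> weights" "y \<in> weights" "x \<noteq> y" "\<alpha> \<in> E7_roots" "c \<noteq> 0"
    and "parallel_to (convex hull {c *\<^sub>R x, c *\<^sub>R y}) \<alpha>"
  shows "x \<bullet> y = 1/2"
proof -
  have "c *\<^sub>R x \<in> convex hull {c *\<^sub>R x, c *\<^sub>R y}" "c *\<^sub>R y \<in> convex hull {c *\<^sub>R x, c *\<^sub>R y}"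
    by (simp_all add: hull_inc)
  then obtain t where "c *\<^sub>R x - c *\<^sub>R y = t *\<^sub>R \<alpha>"
    using assms(6) unfolding parallel_to_def by blast
  then have "(1/c) *\<^sub>R (c *\<^sub>R (x - y)) = (t/c) *\<^sub>R \<alpha>" by (simp add: scaleR_diff_right)
  then obtain s where s: "x - y = s *\<^sub>R \<alpha>" using assms(5) by auto
  have "2 * s = \<alpha> \<bullet> (s *\<^sub>R \<alpha>)" using E7_roots_norm[OF assms(4)] by simp
  also have "\<dots> = \<alpha> \<bullet> x - \<alpha> \<bullet> y" by (simp add: inner_diff_right flip: s)
  finally have "2 * s \<in> {-2, -1, 0, 1, 2}"
    using E7_roots_weights(1)[OF assms(4,1)] E7_roots_weights(1)[OF assms(4,2)] by auto
  then have "s \<in> {-1, -1/2, 0, 1/2, 1}" by auto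
  from imageI[OF this, of "\<lambda>s. s * s"] have s2: "s * s \<in> {0, 1/4, 1}" by auto
  have "(x - y) \<bullet> (x - y) = 2 * (s * s)" unfolding s using E7_roots_norm[OF assms(4)] by simp
  moreover have "(x - y) \<bullet> (x - y) = 3 - 2 * (x \<bullet> y)"
    using weights_inner[OF assms(1,1)] weights_inner[OF assms(2,2)] by (auto simp: inner_diff_left inner_diff_right inner_commute)
  ultimately show ?thesis using s2 weights_inner[OF assms(1,2)] assms(3) by auto
qed

theorem theorem4p13:
  fixes v :: "real^8" and M :: "(real^8 \<Rightarrow> real^8) set set"
  assumes "v \<in> span E7_roots"
    and "stabilizer W_E7 (\<lambda>\<sigma>. \<sigma>) v = P7"
    and "coxeter_matroid E7_roots P7 v M"
  shows "strong_exchange E7_roots v M"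
proof -
  interpret W: group W_E7 by (rule group_weyl_group)
  obtain c where c: "c \<noteq> 0" "v = c *\<^sub>R half_vec pt_w"
    using stabilizer_weight[OF assms(1,2)] by blast
  have "pt_w \<in> set weight_list" using weight_list_frame by simp
  then have wW: "half_vec pt_w \<in> weights" by (simp add: weights_def)
  have coset: "\<sigma> <#\<^bsub>W_E7\<^esub> P7 = {\<rho> \<in> carrier W_E7. \<rho> v = \<sigma> v}" if "\<sigma> \<in> carrier W_E7" for \<sigma>
    using weyl_coset_eq[OF that assms(2)[symmetric]] .
  \<comment> \<open>Dividing the orbit of \<open>v\<close> by \<open>c\<close> gives weights, to
    which the exchange of points applies.\<close>
  define pt where "pt \<sigma> = \<sigma> (half_vec pt_w)" for \<sigma> :: "real^8 \<Rightarrow> real^8"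
  have ptW: "pt \<sigma> \<in> weights" and ptv: "\<sigma> v = c *\<^sub>R pt \<sigma>" if "\<sigma> \<in> carrier W_E7" for \<sigma>
    using weyl_group_E7_weights[OF that] wW by (auto simp: pt_def c linear_scale)
  have coset_cong: "\<sigma> <#\<^bsub>W_E7\<^esub> P7 = \<tau> <#\<^bsub>W_E7\<^esub> P7"
    if "\<sigma> \<in> carrier W_E7" "\<tau> \<in> carrier W_E7" "pt \<sigma> = pt \<tau>" for \<sigma> \<tau>
    unfolding coset[OF that(1)] coset[OF that(2)] ptv[OF that(1)] ptv[OF that(2)] that(3) ..
  define X where "X = {pt \<sigma> | \<sigma>. \<sigma> \<in> carrier W_E7 \<and> \<sigma> <#\<^bsub>W_E7\<^esub> P7 \<in> M}"
  have XW: "X \<subseteq> weights" using ptW by (auto simp: X_def)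
  have "{\<sigma> v | \<sigma>. \<sigma> \<in> carrier W_E7 \<and> \<sigma> <#\<^bsub>W_E7\<^esub> P7 \<in> M} = (*\<^sub>R) c ` X"
    unfolding X_def using ptv by force
  then have poly: "matroid_polytope E7_roots P7 v M = convex hull ((*\<^sub>R) c ` X)"
    by (simp add: matroid_polytope_def)
  have edges: "edges_short c X"
    unfolding edges_short_def
  proof (intro ballI impI)
    fix x y assume xy: "x \<in> X" "y \<in> X" "x \<noteq> y"
      and "convex hull {c *\<^sub>R x, c *\<^sub>R y} edge_of convex hull ((*\<^sub>R) c ` X)"
    then obtain \<alpha> where "\<alpha> \<in> E7_roots" "parallel_to (convex hull {c *\<^sub>R x, c *\<^sub>R y}) \<alpha>"
      using assms(3) poly unfolding coxeter_matroid_def by metis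
    then show "x \<bullet> y = 1/2" using parallel_segment_inner xy XW c(1) by blast
  qed
  show ?thesis
    unfolding strong_exchange_def
  proof (intro ballI impI)
    fix A B assume AB: "A \<in> M" "B \<in> M" "A \<noteq> B"
    then have "A \<in> lcosets\<^bsub>W_E7\<^esub> P7" "B \<in> lcosets\<^bsub>W_E7\<^esub> P7"
      using assms(3) unfolding coxeter_matroid_def by auto
    then obtain \<sigma> \<tau> where \<sigma>: "\<sigma> \<in> carrier W_E7" "A = \<sigma> <#\<^bsub>W_E7\<^esub> P7"
      and \<tau>: "\<tau> \<in> carrier W_E7" "B = \<tau> <#\<^bsub>W_E7\<^esub> P7"
      unfolding LCOSETS_def by blast
    have "pt \<sigma> \<in> X" "pt \<tau> \<in> X" "pt \<sigma> \<noteq> pt \<tau>"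
      using AB \<sigma> \<tau> coset_cong unfolding X_def by blast+
    then obtain \<alpha> where \<alpha>: "\<alpha> \<in> E7_roots" "\<alpha> \<bullet> pt \<sigma> = 1" "\<alpha> \<bullet> pt \<tau> = -1"
      "reflection \<alpha> (pt \<sigma>) \<in> X" "reflection \<alpha> (pt \<tau>) \<in> X"
      using exchange_points[OF edges c(1) XW] by blast
    have r: "reflection \<alpha> \<in> carrier W_E7"
      unfolding carrier_weyl_group using \<alpha>(1) by (rule reflection_in_subgroup)
    have P7: "P7 \<subseteq> carrier W_E7"
      unfolding assms(2)[symmetric] stabilizer_def by blast
    \<comment> \<open>The reflected point belongs to some coset in \<open>M\<close>, and cosets with
      the same point are equal.\<close>
    have move: "reflection \<alpha> <#\<^bsub>W_E7\<^esub> (\<rho> <#\<^bsub>W_E7\<^esub> P7) \<in> M"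
      if \<rho>: "\<rho> \<in> carrier W_E7" and X: "reflection \<alpha> (pt \<rho>) \<in> X" for \<rho>
    proof -
      obtain \<pi> where \<pi>: "\<pi> \<in> carrier W_E7" "\<pi> <#\<^bsub>W_E7\<^esub> P7 \<in> M" "reflection \<alpha> (pt \<rho>) = pt \<pi>"
        using X unfolding X_def by auto
      have "pt (reflection \<alpha> \<otimes>\<^bsub>W_E7\<^esub> \<rho>) = pt \<pi>"
        unfolding mult_weyl_group[OF r \<rho>] using \<pi>(3) by (simp add: pt_def)
      then have "(reflection \<alpha> \<otimes>\<^bsub>W_E7\<^esub> \<rho>) <#\<^bsub>W_E7\<^esub> P7 = \<pi> <#\<^bsub>W_E7\<^esub> P7"
        by (intro coset_cong W.m_closed r \<rho> \<pi>(1))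
      then show ?thesis
        using \<pi>(2) W.lcos_m_assoc[OF P7 r \<rho>] by simp
    qed
    have "mirror_separates v \<alpha> A B"
      unfolding mirror_separates_def
    proof (intro ballI)
      fix \<sigma>' \<tau>' assume "\<sigma>' \<in> A" "\<tau>' \<in> B"
      then have "\<sigma>' v = c *\<^sub>R pt \<sigma>" "\<tau>' v = c *\<^sub>R pt \<tau>"
        using coset[OF \<sigma>(1)] coset[OF \<tau>(1)] ptv[OF \<sigma>(1)] ptv[OF \<tau>(1)] \<sigma>(2) \<tau>(2) by simp_all
      \<comment> \<open>The product is \<open>- (c * c)\<close>, negative for either sign of
        \<open>c\<close>.\<close>
      then show "(\<alpha> \<bullet> \<sigma>' v) * (\<alpha> \<bullet> \<tau>' v) < 0"
        using \<alpha>(2,3) c(1) by (auto simp: zero_less_mult_iff linorder_neq_iff)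
    qed
    then show "\<exists>\<alpha>\<in>E7_roots. mirror_separates v \<alpha> A B \<and>
        reflection \<alpha> <#\<^bsub>W_E7\<^esub> A \<in> M \<and> reflection \<alpha> <#\<^bsub>W_E7\<^esub> B \<in> M"
      using \<alpha> move[OF \<sigma>(1)] move[OF \<tau>(1)] \<sigma>(2) \<tau>(2) by blast
  qed
qed

end
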